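(* For each $\tau>0$, the Fredholm determinant $D_{\mathsf T}(z,\tau)=\det(I-z\mathsf{T}_\tau)$ is an entire function of $z\in\mathbb{C}$ and $$D_{\mathsf T}(z,\tau)=\prod_{\ell=0}^\infty\bigl(1-z\,s_\ell(\tau)\bigr)^{2\ell+1}.$$ It has order zero. More precisely, for every $\varepsilon>0$ there is a constant $C_{\tau,\varepsilon}$ such that $$\log|D_{\mathsf T}(z,\tau)|\le C_{\tau,\varepsilon}(1+|z|)^\varepsilon\qquad\text{for all }z\in\mathbb{C}.$$ The displayed product is the canonical Hadamard product of genus zero of $D_{\mathsf T}(\cdot,\tau)$.
   Context: The Peter--Weyl decomposition is $L^2(\mathrm{SO}(3))\simeq\bigoplus_{\ell\ge0}V_\ell\otimes V_\ell^*$, with $V_\ell$ the irreducible unitary $\mathrm{SO}(3)$ representation of dimension $2\ell+1$. Via a fixed equivariant unitary identification, $V_\ell^*\simeq V_\ell\simeq\mathrm{Sym}^{2\ell}\mathbb{C}^2$, the homogeneous polynomials of degree $2\ell$ in $(z_0,z_1)$, with the invariant inner product for which monomials are orthogonal and $\|z_0^{2\ell-k}z_1^k\|^2=\binom{2\ell}{k}^{-1}$. Put $u_\ell=z_0^{2\ell}$, $w_\ell(\tau)=(z_0^2+z_1^2+2\coth\tau\,z_0z_1)^\ell$, $\widehat v=v/\|v\|$, and $s_\ell(\tau)=|\langle\widehat w_\ell(\tau),\widehat u_\ell\rangle|^2$. The two Hardy spaces (of the unit circle bundle $Y$ of $\mathcal{O}(-2)\to\mathbb{CP}^1$ and of the boundary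 of the radius-$\tau$ Grauert tube of the round $\mathbb{S}^2$) are realized as $$H^2(Y)=\widehat{\bigoplus_{\ell\ge0}}V_\ell\otimes\mathbb{C}u_\ell,\qquad H^2(\partial M_\tau)=\widehat{\bigoplus_{\ell\ge0}}V_\ell\otimes\mathbb{C}w_\ell(\tau),$$ with orthogonal projectors $\Pi_h$, $\Pi_\tau$, and $\mathsf{T}_\tau=\Pi_h\Pi_\tau\Pi_h\colon H^2(Y)\to H^2(Y)$, a positive trace-class operator. *)

theory Defs
  imports "HOL-Complex_Analysis.Complex_Analysis" "HOL-Computational_Algebra.Polynomial"
    "HOL-Combinatorics.Permutations"
begin

section \<open>The spaces \<open>V\<^sub>l = Sym\<^sup>2\<^sup>l \<complex>\<^sup>2\<close>\<close>

text \<open>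
  Polynomials in \<open>(z\<^sub>0, z\<^sub>1)\<close> are polynomials in \<open>z\<^sub>1\<close> over \<open>\<complex>[z\<^sub>0]\<close>: the coefficient of
  \<open>z\<^sub>0\<^sup>i z\<^sub>1\<^sup>j\<close> in \<open>p\<close> is \<open>coeff (coeff p j) i\<close>.
\<close>

definition Z0 :: "complex poly poly" where "Z0 = [:[:0, 1:]:]"

definition Z1 :: "complex poly poly" where "Z1 = [:0, 1:]"

definition cscale :: "complex \<Rightarrow> complex poly poly \<Rightarrow> complex poly poly" where
  "cscale c p = smult [:c:] p"

definition Sym :: "nat \<Rightarrow> complex poly poly set" where
  "Sym l = {p. \<forall>i j. coeff (coeff p j) i \<noteq> 0 \<longrightarrow> i + j = 2 * l}"

text \<open>The coefficient of \<open>z\<^sub>0\<^sup>2\<^sup>l\<^sup>-\<^sup>k z\<^sub>1\<^sup>k\<close>; only used for \<open>p \<in> Sym l\<close>.\<close>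

definition mcoeff :: "nat \<Rightarrow> complex poly poly \<Rightarrow> nat \<Rightarrow> complex" where
  "mcoeff l p k = coeff (coeff p k) (2 * l - k)"

definition sym_inner :: "nat \<Rightarrow> complex poly poly \<Rightarrow> complex poly poly \<Rightarrow> complex" where
  "sym_inner l p q = (\<Sum>k\<le>2*l. mcoeff l p k * cnj (mcoeff l q k) / of_nat ((2*l) choose k))"

definition sym_norm :: "nat \<Rightarrow> complex poly poly \<Rightarrow> real" where
  "sym_norm l p = sqrt (Re (sym_inner l p p))"

definition sym_hat :: "nat \<Rightarrow> complex poly poly \<Rightarrow> complex poly poly" where
  "sym_hat l p = cscale (of_real (1 / sym_norm l p)) p"

definition u_vec :: "nat \<Rightarrow> complex poly poly" where
  "u_vec l = Z0 ^ (2 * l)"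

definition w_vec :: "real \<Rightarrow> nat \<Rightarrow> complex poly poly" where
  "w_vec \<tau> l = (Z0\<^sup>2 + Z1\<^sup>2 + cscale (of_real (2 * (cosh \<tau> / sinh \<tau>))) (Z0 * Z1)) ^ l"

definition s_coef :: "nat \<Rightarrow> real \<Rightarrow> real" where
  "s_coef l \<tau> = (cmod (sym_inner l (sym_hat l (w_vec \<tau> l)) (sym_hat l (u_vec l))))\<^sup>2"


section \<open>The Hilbert sum of the spaces \<open>V\<^sub>l \<otimes> V\<^sub>l\<close>\<close>

text \<open>
  An element of \<open>V\<^sub>l \<otimes> V\<^sub>l\<close> is given by its coefficients \<open>A k j\<close> with respect to the basis
  \<open>z\<^sub>0\<^sup>2\<^sup>l\<^sup>-\<^sup>k z\<^sub>1\<^sup>k \<otimes> z\<^sub>0\<^sup>2\<^sup>l\<^sup>-\<^sup>j z\<^sub>1\<^sup>j\<close>.  The inner product is the tensor product one, that is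
  \<open>\<langle>p \<otimes> q, p' \<otimes> q'\<rangle> = \<langle>p, p'\<rangle> \<langle>q, q'\<rangle>\<close>.
\<close>

definition tensor_space :: "nat \<Rightarrow> (nat \<Rightarrow> nat \<Rightarrow> complex) set" where
  "tensor_space l = {A. \<forall>k j. A k j \<noteq> 0 \<longrightarrow> k \<le> 2 * l \<and> j \<le> 2 * l}"

definition tensor :: "nat \<Rightarrow> complex poly poly \<Rightarrow> complex poly poly \<Rightarrow> nat \<Rightarrow> nat \<Rightarrow> complex" where
  "tensor l p q = (\<lambda>k j. mcoeff l p k * mcoeff l q j)"

definition tensor_inner :: "nat \<Rightarrow> (nat \<Rightarrow> nat \<Rightarrow> complex) \<Rightarrow> (nat \<Rightarrow> nat \<Rightarrow> complex) \<Rightarrow> complex" where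
  "tensor_inner l A B = (\<Sum>k\<le>2*l. \<Sum>j\<le>2*l.
     A k j * cnj (B k j) / (of_nat ((2*l) choose k) * of_nat ((2*l) choose j)))"

text \<open>
  \<open>pw_space\<close> is \<open>L\<^sup>2(SO(3))\<close> on the Peter--Weyl side, with \<open>V\<^sub>l\<^sup>*\<close> identified with \<open>V\<^sub>l\<close>;
  \<open>f l\<close> is the component of \<open>f\<close> in \<open>V\<^sub>l \<otimes> V\<^sub>l\<close>.
\<close>

type_synonym pw = "nat \<Rightarrow> nat \<Rightarrow> nat \<Rightarrow> complex"

definition pw_space :: "pw set" where
  "pw_space = {f. (\<forall>l. f l \<in> tensor_space l) \<and> summable (\<lambda>l. Re (tensor_inner l (f l) (f l)))}"

definition pw_inner :: "pw \<Rightarrow> pw \<Rightarrow> complex" where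
  "pw_inner f g = (\<Sum>l. tensor_inner l (f l) (g l))"

definition pw_norm :: "pw \<Rightarrow> real" where
  "pw_norm f = sqrt (Re (pw_inner f f))"

definition pw_scale :: "complex \<Rightarrow> pw \<Rightarrow> pw" where
  "pw_scale c f = (\<lambda>l k j. c * f l k j)"

text \<open>The completed direct sum of the spaces \<open>V\<^sub>l \<otimes> \<complex> v\<^sub>l\<close>.\<close>

definition hardy_sum :: "(nat \<Rightarrow> complex poly poly) \<Rightarrow> pw set" where
  "hardy_sum v = {f \<in> pw_space. \<forall>l. \<exists>p\<in>Sym l. \<exists>c. f l = tensor l p (cscale c (v l))}"

definition hardy_Y :: "pw set" where
  "hardy_Y = hardy_sum u_vec"

definition hardy_tube :: "real \<Rightarrow> pw set" where
  "hardy_tube \<tau> = hardy_sum (w_vec \<tau>)"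

definition orth_proj :: "pw set \<Rightarrow> pw \<Rightarrow> pw" where
  "orth_proj M f = (THE g. g \<in> M \<and> (\<forall>m\<in>M. pw_inner (f - g) m = 0))"

definition T_op :: "real \<Rightarrow> pw \<Rightarrow> pw" where
  "T_op \<tau> = orth_proj hardy_Y \<circ> orth_proj (hardy_tube \<tau>) \<circ> orth_proj hardy_Y"


section \<open>The Fredholm determinant\<close>

text \<open>Hilbert bases: orthonormal systems with dense linear span.\<close>

definition hilbert_basis :: "pw set \<Rightarrow> pw set \<Rightarrow> bool" where
  "hilbert_basis H E \<longleftrightarrow> E \<subseteq> H \<and>
     (\<forall>e\<in>E. \<forall>f\<in>E. pw_inner e f = (if e = f then 1 else 0)) \<and>
     (\<forall>x\<in>H. \<forall>\<epsilon>>0. \<exists>S c. finite S \<and> S \<subseteq> E \<and>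
        pw_norm (\<lambda>l k j. x l k j - (\<Sum>e\<in>S. c e * e l k j)) < \<epsilon>)"

text \<open>The determinant of a matrix with rows and columns indexed by a finite set.\<close>

definition det_on :: "'i set \<Rightarrow> ('i \<Rightarrow> 'i \<Rightarrow> complex) \<Rightarrow> complex" where
  "det_on S M = (\<Sum>\<pi> | \<pi> permutes S. of_int (sign \<pi>) * (\<Prod>i\<in>S. M i (\<pi> i)))"

text \<open>
  The trace of the \<open>n\<close>-th exterior power of \<open>A\<close> on \<open>H\<close>.  If \<open>E\<close> is a Hilbert basis of \<open>H\<close>, then
  the wedge products of the \<open>n\<close>-element subsets \<open>S\<close> of \<open>E\<close> form a Hilbert basis of the exterior
  power, and the corresponding diagonal matrix coefficient of the exterior power of \<open>A\<close> is
  \<open>det (\<langle>A f, e\<rangle>)\<close> with \<open>e, f \<in> S\<close>.  For \<open>A\<close> of trace class the sum of these converges absolutely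
  and does not depend on \<open>E\<close>; both are required of the value selected here.
\<close>

definition trace_ext_power :: "pw set \<Rightarrow> (pw \<Rightarrow> pw) \<Rightarrow> nat \<Rightarrow> complex" where
  "trace_ext_power H A n = (THE t. \<forall>E. hilbert_basis H E \<longrightarrow>
     ((\<lambda>S. det_on S (\<lambda>e f. pw_inner (A f) e)) has_sum t) {S. S \<subseteq> E \<and> finite S \<and> card S = n})"

text \<open>\<open>det (I + A)\<close> as the sum of the traces of the exterior powers of the trace class operator \<open>A\<close>.\<close>

definition det_id_plus :: "pw set \<Rightarrow> (pw \<Rightarrow> pw) \<Rightarrow> complex" where
  "det_id_plus H A = (\<Sum>n. trace_ext_power H A n)"

definition D_T :: "real \<Rightarrow> complex \<Rightarrow> complex" where
  "D_T \<tau> z = det_id_plus hardy_Y (\<lambda>f. pw_scale (- z) (T_op \<tau> f))"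


section \<open>Order and canonical products of entire functions\<close>

definition max_modulus :: "(complex \<Rightarrow> complex) \<Rightarrow> real \<Rightarrow> real" where
  "max_modulus f r = (SUP z\<in>sphere 0 r. cmod (f z))"

text \<open>The order of a non-constant entire function.\<close>

definition entire_order :: "(complex \<Rightarrow> complex) \<Rightarrow> ereal" where
  "entire_order f = Limsup at_top (\<lambda>r. ereal (ln (ln (max_modulus f r)) / ln r))"

text \<open>
  \<open>f\<close> is the canonical product of genus \<open>p\<close> over its zeros, where the zeros are listed by \<open>a\<close>, the
  entry \<open>a n\<close> being counted \<open>m n\<close> times.  The same point may be listed more than once.  The
  condition on \<^const>\<open>zorder\<close> excludes a zero at the origin, so the Hadamard factorisation of \<open>f\<close>
  has neither a monomial nor an exponential factor.
\<close>

definition canonical_product ::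
    "nat \<Rightarrow> (nat \<Rightarrow> complex) \<Rightarrow> (nat \<Rightarrow> nat) \<Rightarrow> (complex \<Rightarrow> complex) \<Rightarrow> bool" where
  "canonical_product p a m f \<longleftrightarrow>
     (\<forall>n. a n \<noteq> 0 \<and> m n > 0) \<and>
     (\<forall>c. finite {n. a n = c} \<and> zorder f c = int (\<Sum>n | a n = c. m n)) \<and>
     summable (\<lambda>n. real (m n) / cmod (a n) ^ (p + 1)) \<and>
     (\<forall>q<p. \<not> summable (\<lambda>n. real (m n) / cmod (a n) ^ (q + 1))) \<and>
     (\<forall>z. (\<lambda>n. weierstrass_factor p (z / a n) ^ m n) has_prod f z)"

end

theory Submission
  imports Defs "HOL-Library.Discrete_Functions"
begin

text \<open>
  Both projections act on the second tensor factor only, so on \<^const>\<open>hardy_Y\<close> the operator is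
  multiplication by \<open>s\<^sub>l\<close> on each \<open>V\<^sub>l \<otimes> u\<^sub>l\<close>.  For a Hilbert basis \<open>E\<close> with coordinates \<open>U\<close>
  the matrix of a diagonal operator is \<open>\<Sum>\<^sub>i \<mu>\<^sub>i U\<^sub>f\<^sub>i cnj U\<^sub>e\<^sub>i\<close>; expanding the minors over injections of
  \<open>{..<n}\<close> and exchanging the absolutely convergent sums over \<open>E\<close> and over the indices \<open>i\<close>
  (columns of \<open>U\<close> are orthonormal by Parseval) gives the elementary symmetric function
  \<open>e\<^sub>n(\<mu>)\<close>, whatever \<open>E\<close> is.  Summing over \<open>n\<close> yields \<open>\<Prod> (1 + \<mu>\<^sub>i)\<close>.  Since \<open>s\<^sub>l \<le> 4\<^sup>-\<^sup>l\<close>, the sum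
  \<open>\<Sum> (2 l + 1) s\<^sub>l\<^sup>\<delta>\<close> converges for every \<open>\<delta> > 0\<close>, and \<open>1 + x \<le> exp (C\<^sub>\<delta> x\<^sup>\<delta>)\<close> bounds the growth.
\<close>

text \<open>\<open>trace_ext_power\<close> asks for one value that serves every Hilbert basis. A
  basis is a bare set without enumeration, so series over it are unordered sums
  (\<open>has_sum\<close>), and at least one basis has to be exhibited before the value is unique.
  Sums of minors over subsets do not split into independent sums, whereas sums over tuples do.
  Passing to tuples costs a factor n! on the basis side and the same factor on the index side, so it
  cancels. What licenses the exchange of sums is a uniform bound: the absolute sum of a product of
  two columns of \<open>U\<close> is at most 1, which leaves the summable \<open>\<mu>\<close> as
  dominating factor. Multiplicities 2l+1 are spelled out by listing the eigenvalues along n = l^2 +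
  k with k \<le> 2l. The determinant then is an ordinary Weierstrass product of genus zero, and
  holomorphy and orders of zeros come from the theory of such products.\<close>

no_notation Infinite_Set_Sum.abs_summable_on (infix "abs'_summable'_on" 50)

section \<open>Sums of principal minors\<close>

text \<open>Composing every permutation with the transposition of \<open>i\<close> and
  \<open>j\<close> flips its sign but not its product, so the sum equals its own negative.\<close>

lemma det_on_identical_rows:
  assumes "finite S" and ij: "i \<in> S" "j \<in> S" "i \<noteq> j" and rows: "\<And>k. k \<in> S \<Longrightarrow> M i k = M j k"
  shows "det_on S M = 0"
proof -
  let ?t = "Transposition.transpose i j"
  let ?P = "{\<pi>. \<pi> permutes S}"
  have t: "?t permutes S"
    using ij by (simp add: permutes_swap_id)
  have "det_on S M = (\<Sum>\<pi>\<in>?P. of_int (sign (\<pi> \<circ> ?t)) * (\<Prod>k\<in>S. M k ((\<pi> \<circ> ?t) k)))"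
    unfolding det_on_def by (rule sum_permutations_compose_right[OF t])
  also have "\<dots> = (\<Sum>\<pi>\<in>?P. - (of_int (sign \<pi>) * (\<Prod>k\<in>S. M k (\<pi> k))))"
  proof (rule sum.cong[OF refl])
    fix \<pi> assume "\<pi> \<in> ?P"
    then have \<pi>: "\<pi> permutes S"
      by simp
    have "sign (\<pi> \<circ> ?t) = - sign \<pi>"
      using permutation_permutes \<pi> \<open>finite S\<close> ij
      by (subst sign_compose) (auto simp: sign_swap_id permutation_swap_id)
    moreover have "(\<Prod>k\<in>S. M k ((\<pi> \<circ> ?t) k)) = (\<Prod>k\<in>S. M (?t k) (\<pi> (?t k)))"
      using rows permutes_in_image[OF \<pi>] ij
      by (intro prod.cong) (auto simp: Transposition.transpose_def)
    moreover have "\<dots> = (\<Prod>k\<in>S. M k (\<pi> k))"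
      using prod.permute[OF t, of "\<lambda>k. M k (\<pi> k)"] by (simp add: o_def)
    ultimately show "of_int (sign (\<pi> \<circ> ?t)) * (\<Prod>k\<in>S. M k ((\<pi> \<circ> ?t) k))
        = - (of_int (sign \<pi>) * (\<Prod>k\<in>S. M k (\<pi> k)))"
      by simp
  qed
  also have "\<dots> = - det_on S M"
    by (simp add: det_on_def sum_negf)
  finally show ?thesis
    by simp
qed

text \<open>Conjugation by \<open>h\<close> matches the permutations of \<open>A\<close> with those
  of the image and preserves signs. Needed to pass from minors indexed by tuples to minors indexed
  by sets.\<close>

lemma det_on_image:
  assumes h: "inj_on h A" and "finite A"
  shows "det_on (h ` A) M = det_on A (\<lambda>i j. M (h i) (h j))"
proof -
  have bij: "bij_betw h A (h ` A)"
    using h by (simp add: bij_betw_def)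
  have "det_on A (\<lambda>i j. M (h i) (h j)) =
      (\<Sum>\<pi> | \<pi> permutes h ` A. of_int (sign \<pi>) * (\<Prod>i\<in>h ` A. M i (\<pi> i)))"
    unfolding det_on_def
  proof (rule sum.reindex_bij_witness[where
        j = "map_permutation A h" and i = "map_permutation (h ` A) (inv_into A h)"])
    fix \<pi> assume "\<pi> \<in> {\<pi>. \<pi> permutes A}"
    then have \<pi>: "\<pi> permutes A"
      by simp
    show "map_permutation (h ` A) (inv_into A h) (map_permutation A h \<pi>) = \<pi>"
      using h \<pi> by (intro map_permutation_compose_inv[OF bij]) auto
    show "map_permutation A h \<pi> \<in> {\<pi>. \<pi> permutes h ` A}"
      using map_permutation_permutes[OF bij \<pi>] by simp
    show "of_int (sign (map_permutation A h \<pi>)) * (\<Prod>i\<in>h ` A. M i (map_permutation A h \<pi> i)) =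
        of_int (sign \<pi>) * (\<Prod>i\<in>A. M (h i) (h (\<pi> i)))"
      using h \<pi> \<open>finite A\<close>
      by (simp add: sign_map_permutation prod.reindex map_permutation_apply)
  next
    fix \<pi> assume "\<pi> \<in> {\<pi>. \<pi> permutes h ` A}"
    then have \<pi>: "\<pi> permutes h ` A"
      by simp
    have bij': "bij_betw (inv_into A h) (h ` A) A"
      by (rule bij_betw_inv_into[OF bij])
    show "map_permutation (h ` A) (inv_into A h) \<pi> \<in> {\<pi>. \<pi> permutes A}"
      using map_permutation_permutes[OF bij' \<pi>] by simp
    show "map_permutation A h (map_permutation (h ` A) (inv_into A h) \<pi>) = \<pi>"
      using \<pi> by (intro map_permutation_compose_inv[OF bij']) (auto simp: f_inv_into_f)
  qed
  then show ?thesis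
    by (simp add: det_on_def)
qed

section \<open>Products of summable families, and the passage from tuples to subsets\<close>

text \<open>A family that is not summable has \<open>infsum\<close> 0, so a nonzero value of the
  product formula already proves summability. If the value is 0, some \<open>f x\<close> vanishes on
  all of \<open>B x\<close>, and every product vanishes with it.\<close>

lemma abs_summable_on_prod_PiE:
  fixes f :: "'a \<Rightarrow> 'b \<Rightarrow> complex"
  assumes "finite A" and f: "\<And>x. x \<in> A \<Longrightarrow> f x abs_summable_on B x"
  shows "(\<lambda>g. \<Prod>x\<in>A. f x (g x)) abs_summable_on PiE A B"
proof -
  have eq: "infsum (\<lambda>g. \<Prod>x\<in>A. norm (f x (g x))) (PiE A B) = (\<Prod>x\<in>A. infsum (\<lambda>y. norm (f x y)) (B x))"
    using assms by (intro infsum_prod_PiE_abs) auto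
  have "(\<lambda>g. \<Prod>x\<in>A. norm (f x (g x))) summable_on PiE A B"
  proof (cases "(\<Prod>x\<in>A. infsum (\<lambda>y. norm (f x y)) (B x)) = 0")
    case False
    show ?thesis
    proof (rule ccontr)
      assume "\<not> ?thesis"
      from infsum_not_exists[OF this] eq False show False
        by simp
    qed
  next
    case True
    then obtain x where x: "x \<in> A" "infsum (\<lambda>y. norm (f x y)) (B x) = 0"
      using \<open>finite A\<close> by auto
    have "f x y = 0" if "y \<in> B x" for y
      using nonneg_infsum_le_0D[of "\<lambda>y. norm (f x y)" "B x" y] x f that by auto
    then have "(\<Prod>x\<in>A. norm (f x (g x))) = 0" if "g \<in> PiE A B" for g
      using that x \<open>finite A\<close> by (auto intro!: prod_zero bexI[of _ x])
    then show ?thesis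
      by (subst summable_on_cong[where g = "\<lambda>_. 0"]) auto
  qed
  then show ?thesis
    by (simp add: prod_norm)
qed

lemma has_sum_prod_PiE:
  fixes f :: "'a \<Rightarrow> 'b \<Rightarrow> complex"
  assumes "finite A" and "\<And>x. x \<in> A \<Longrightarrow> f x abs_summable_on B x"
    and "\<And>x. x \<in> A \<Longrightarrow> (f x has_sum s x) (B x)"
  shows "((\<lambda>g. \<Prod>x\<in>A. f x (g x)) has_sum (\<Prod>x\<in>A. s x)) (PiE A B)"
proof -
  have "infsum (\<lambda>g. \<Prod>x\<in>A. f x (g x)) (PiE A B) = (\<Prod>x\<in>A. infsum (f x) (B x))"
    using assms by (intro infsum_prod_PiE_abs) auto
  also have "\<dots> = (\<Prod>x\<in>A. s x)"
    using assms by (intro prod.cong infsumI) auto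
  finally have "infsum (\<lambda>g. \<Prod>x\<in>A. f x (g x)) (PiE A B) = (\<Prod>x\<in>A. s x)" .
  moreover have "(\<lambda>g. \<Prod>x\<in>A. f x (g x)) summable_on PiE A B"
    by (rule abs_summable_summable[OF abs_summable_on_prod_PiE[OF assms(1,2)]])
  ultimately show ?thesis
    using has_sum_infsum by metis
qed

lemma has_sum_sum:
  fixes f :: "'a \<Rightarrow> 'b \<Rightarrow> 'c::topological_comm_monoid_add"
  assumes "finite A" and "\<And>x. x \<in> A \<Longrightarrow> (f x has_sum s x) B"
  shows "((\<lambda>y. \<Sum>x\<in>A. f x y) has_sum (\<Sum>x\<in>A. s x)) B"
  using assms by (induction A rule: finite_induct) (auto intro: has_sum_add)

text \<open>Each n-element set is the image of exactly n! injective tuples;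
  \<open>\<Prod>i<n. n - i\<close> is n! in the form in which injections are counted.\<close>

lemma has_sum_card_subsets:
  fixes F :: "'i set \<Rightarrow> complex"
  assumes "((\<lambda>\<kappa>. if inj_on \<kappa> {..<n} then F (\<kappa> ` {..<n}) else 0) has_sum t) (PiE {..<n} (\<lambda>_. I))"
  shows "(F has_sum (t / of_nat (\<Prod>i<n. n - i))) {S. S \<subseteq> I \<and> finite S \<and> card S = n}"
proof -
  let ?inj = "\<lambda>S. {\<kappa> \<in> {..<n} \<rightarrow>\<^sub>E S. inj_on \<kappa> {..<n}}"
  let ?\<S> = "{S. S \<subseteq> I \<and> finite S \<and> card S = n}"
  have "((\<lambda>\<kappa>. F (\<kappa> ` {..<n})) has_sum t) (?inj I)"
    by (rule has_sum_cong_neutral[THEN iffD1, OF _ _ _ assms]) auto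
  moreover have "bij_betw (\<lambda>\<kappa>. (\<kappa> ` {..<n}, \<kappa>)) (?inj I) (Sigma ?\<S> ?inj)"
  proof (rule bij_betwI')
    fix p assume "p \<in> Sigma ?\<S> ?inj"
    then obtain S \<kappa> where p: "p = (S, \<kappa>)" and S: "S \<subseteq> I" "finite S" "card S = n"
      and \<kappa>: "\<kappa> \<in> {..<n} \<rightarrow>\<^sub>E S" "inj_on \<kappa> {..<n}"
      by auto
    have "\<kappa> ` {..<n} \<subseteq> S" "card (\<kappa> ` {..<n}) = card S"
      using S \<kappa> by (auto simp: card_image)
    then have "\<kappa> ` {..<n} = S"
      using S card_subset_eq by blast
    moreover have "\<kappa> \<in> ?inj I"
      using \<kappa> S by (auto simp: PiE_iff)
    ultimately show "\<exists>\<kappa>\<in>?inj I. p = (\<kappa> ` {..<n}, \<kappa>)"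
      using p by blast
  qed (auto simp: card_image)
  ultimately have "((\<lambda>(S, \<kappa>). F S) has_sum t) (Sigma ?\<S> ?inj)"
    using has_sum_reindex_bij_betw[of "\<lambda>\<kappa>. (\<kappa> ` {..<n}, \<kappa>)" "?inj I" _ "\<lambda>(S, \<kappa>). F S"] by simp
  then have "((\<lambda>S. of_nat (\<Prod>i<n. n - i) * F S) has_sum t) ?\<S>"
  proof (rule has_sum_Sigma')
    fix S assume S: "S \<in> ?\<S>"
    have "card (?inj S) = (\<Prod>i<n. n - i)"
      using S card_inj_on_subset_funcset[of "{..<n}" S "{..<n}"] by (simp add: lessThan_atLeast0)
    moreover have "finite (?inj S)"
      using S by (auto intro: finite_subset[of _ "{..<n} \<rightarrow>\<^sub>E S"] finite_PiE)
    ultimately show "((\<lambda>\<kappa>. case (S, \<kappa>) of (S, \<kappa>) \<Rightarrow> F S) has_sum of_nat (\<Prod>i<n. n - i) * F S) (?inj S)"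
      by (intro has_sum_finiteI) auto
  qed
  moreover have "(\<Prod>i<n. n - i) \<noteq> 0"
    by (subst prod_zero_iff) auto
  ultimately show ?thesis
    by (subst (asm) has_sum_cmult_right_iff) auto
qed

text \<open>A basis-free trace formula for exterior powers: \<open>U e i\<close> is the i-th
  coordinate of the basis vector \<open>e\<close>, and \<open>M e f\<close> is the matrix entry of
  the diagonal operator \<open>\<mu>\<close>. Both sums are, up to n!, iterated sums of one double
  family \<open>g\<close>, taken in opposite orders.\<close>

theorem has_sum_principal_minors:
  fixes U :: "'e \<Rightarrow> 'i \<Rightarrow> complex"
  assumes \<mu>: "\<mu> abs_summable_on I"
    and U: "\<And>i j. i \<in> I \<Longrightarrow> j \<in> I \<Longrightarrow> ((\<lambda>e. U e i * cnj (U e j)) has_sum (if i = j then 1 else 0)) E"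
    and M: "\<And>e f. e \<in> E \<Longrightarrow> f \<in> E \<Longrightarrow> ((\<lambda>i. \<mu> i * U f i * cnj (U e i)) has_sum M e f) I"
  shows "((\<lambda>S. det_on S M) has_sum (\<Sum>\<^sub>\<infinity>J\<in>{J. J \<subseteq> I \<and> finite J \<and> card J = n}. \<Prod>i\<in>J. \<mu> i))
           {S. S \<subseteq> E \<and> finite S \<and> card S = n}"
proof -
  define PI where "PI = {..<n} \<rightarrow>\<^sub>E I"
  define PE where "PE = {..<n} \<rightarrow>\<^sub>E E"
  define \<delta> :: "'i \<Rightarrow> 'i \<Rightarrow> complex" where "\<delta> i j = (if i = j then 1 else 0)" for i j
  let ?P = "{\<pi>. \<pi> permutes {..<n}}"
  define g where "g \<pi> \<iota> \<kappa> =
     (\<Prod>j<n. \<mu> (\<iota> j) * U (\<kappa> (\<pi> j)) (\<iota> j) * cnj (U (\<kappa> j) (\<iota> j)))" for \<pi> :: "nat \<Rightarrow> nat" and \<iota> \<kappa>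

  have sq: "((\<lambda>e. (cmod (U e i))\<^sup>2) has_sum 1) E" if "i \<in> I" for i
  proof -
    have "((\<lambda>e. Re (U e i * cnj (U e i))) has_sum Re 1) E"
      using U[OF that that] by (intro has_sum_Re) simp
    then show ?thesis
      by (simp add: complex_norm_square[symmetric])
  qed
  \<comment> \<open>By AM-GM this majorant dominates the product of two columns. Its sum is exactly
    1, so the bound is uniform in \<open>i\<close> and \<open>j\<close>.\<close>
  have half: "((\<lambda>e. ((cmod (U e i))\<^sup>2 + (cmod (U e j))\<^sup>2) / 2) has_sum 1) E" if "i \<in> I" "j \<in> I" for i j
    using has_sum_add[OF sq[OF that(1)] sq[OF that(2)]] by (auto dest: has_sum_divide_const[of _ _ _ 2])
  have le_half: "norm (U e i * cnj (U e j)) \<le> ((cmod (U e i))\<^sup>2 + (cmod (U e j))\<^sup>2) / 2" for e i j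
    using sum_squares_bound[of "cmod (U e i)" "cmod (U e j)"] by (simp add: norm_mult)
  have U_abs: "(\<lambda>e. U e i * cnj (U e j)) abs_summable_on E" if "i \<in> I" "j \<in> I" for i j
    by (rule Infinite_Sum.abs_summable_on_comparison_test'[OF has_sum_imp_summable[OF half[OF that]]]) (rule le_half)
  have U_abs_le: "infsum (\<lambda>e. norm (U e i * cnj (U e j))) E \<le> 1" if "i \<in> I" "j \<in> I" for i j
    using infsum_mono[OF U_abs[OF that] has_sum_imp_summable[OF half[OF that]]] le_half
      infsumI[OF half[OF that]] by auto
  have U_le: "cmod (U e i) \<le> 1" if "e \<in> E" "i \<in> I" for e i
  proof -
    have "(cmod (U e i))\<^sup>2 \<le> 1"
      using finite_sum_le_has_sum[OF sq[OF that(2)], of "{e}"] that by auto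
    then show ?thesis
      by (simp add: power_le_one_iff abs_square_le_1)
  qed
  have M_abs: "(\<lambda>i. \<mu> i * U f i * cnj (U e i)) abs_summable_on I" if "e \<in> E" "f \<in> E" for e f
  proof (rule Infinite_Sum.abs_summable_on_comparison_test[OF \<mu>])
    fix i assume "i \<in> I"
    then have "cmod (U f i) * cmod (U e i) \<le> 1"
      using U_le that by (intro mult_le_one) auto
    then show "cmod (\<mu> i * U f i * cnj (U e i)) \<le> cmod (\<mu> i)"
      by (simp add: norm_mult mult.assoc mult_left_le)
  qed

  \<comment> \<open>Reindexing by the inverse of \<open>\<pi>\<close> collects both occurrences of
    \<open>\<kappa> j\<close> in one factor, so that the sum over \<open>\<kappa>\<close> splits
    coordinatewise.\<close>
  have g_alt: "g \<pi> \<iota> \<kappa> = (\<Prod>j<n. \<mu> (\<iota> j)) * (\<Prod>j<n. U (\<kappa> j) (\<iota> (inv \<pi> j)) * cnj (U (\<kappa> j) (\<iota> j)))"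
    if "\<pi> permutes {..<n}" for \<pi> \<iota> \<kappa>
  proof -
    have "(\<Prod>j<n. U (\<kappa> (\<pi> j)) (\<iota> j)) = (\<Prod>j<n. U (\<kappa> j) (\<iota> (inv \<pi> j)))"
      using prod.permute[OF that, of "\<lambda>j. U (\<kappa> j) (\<iota> (inv \<pi> j))"] permutes_inverses[OF that]
      by (simp add: o_def)
    then show ?thesis
      by (simp add: g_def prod.distrib)
  qed
  have inner: "((\<lambda>\<kappa>. g \<pi> \<iota> \<kappa>) has_sum (\<Prod>j<n. \<mu> (\<iota> j)) * (\<Prod>j<n. \<delta> (\<iota> j) (\<iota> (\<pi> j)))) PE"
    "(\<lambda>\<kappa>. g \<pi> \<iota> \<kappa>) abs_summable_on PE"
    "infsum (\<lambda>\<kappa>. norm (g \<pi> \<iota> \<kappa>)) PE \<le> norm (\<Prod>j<n. \<mu> (\<iota> j))"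
    if \<pi>: "\<pi> permutes {..<n}" and \<iota>: "\<iota> \<in> PI" for \<pi> \<iota>
  proof -
    have \<iota>I: "\<iota> j \<in> I" "\<iota> (inv \<pi> j) \<in> I" if "j < n" for j
      using \<iota> that permutes_in_image[OF permutes_inv[OF \<pi>], of j] by (auto simp: PI_def)
    have "((\<lambda>\<kappa>. \<Prod>j<n. U (\<kappa> j) (\<iota> (inv \<pi> j)) * cnj (U (\<kappa> j) (\<iota> j))) has_sum
        (\<Prod>j<n. \<delta> (\<iota> (inv \<pi> j)) (\<iota> j))) PE"
      unfolding PE_def
      by (rule has_sum_prod_PiE) (use U[folded \<delta>_def] U_abs \<iota>I in auto)
    moreover have "(\<Prod>j<n. \<delta> (\<iota> (inv \<pi> j)) (\<iota> j)) = (\<Prod>j<n. \<delta> (\<iota> j) (\<iota> (\<pi> j)))"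
      using prod.permute[OF \<pi>, of "\<lambda>j. \<delta> (\<iota> (inv \<pi> j)) (\<iota> j)"] permutes_inverses[OF \<pi>]
      by (simp add: o_def)
    ultimately show "((\<lambda>\<kappa>. g \<pi> \<iota> \<kappa>) has_sum (\<Prod>j<n. \<mu> (\<iota> j)) * (\<Prod>j<n. \<delta> (\<iota> j) (\<iota> (\<pi> j)))) PE"
      unfolding g_alt[OF \<pi>] by (intro has_sum_cmult_right) simp
    have abs: "(\<lambda>\<kappa>. \<Prod>j<n. U (\<kappa> j) (\<iota> (inv \<pi> j)) * cnj (U (\<kappa> j) (\<iota> j))) abs_summable_on PE"
      unfolding PE_def by (rule abs_summable_on_prod_PiE) (auto intro!: U_abs \<iota>I)
    then show "(\<lambda>\<kappa>. g \<pi> \<iota> \<kappa>) abs_summable_on PE"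
      unfolding g_alt[OF \<pi>] norm_mult[of "\<Prod>j<n. \<mu> (\<iota> j)"] by (rule summable_on_cmult_right)
    have "infsum (\<lambda>\<kappa>. \<Prod>j<n. norm (U (\<kappa> j) (\<iota> (inv \<pi> j)) * cnj (U (\<kappa> j) (\<iota> j)))) PE
        = (\<Prod>j<n. infsum (\<lambda>e. norm (U e (\<iota> (inv \<pi> j)) * cnj (U e (\<iota> j)))) E)"
      unfolding PE_def using U_abs \<iota>I by (intro infsum_prod_PiE_abs) auto
    also have "\<dots> \<le> 1"
      using U_abs_le \<iota>I by (intro prod_le_1) (auto intro!: infsum_nonneg)
    finally have "norm (\<Prod>j<n. \<mu> (\<iota> j)) *
        infsum (\<lambda>\<kappa>. norm (\<Prod>j<n. U (\<kappa> j) (\<iota> (inv \<pi> j)) * cnj (U (\<kappa> j) (\<iota> j)))) PE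
        \<le> norm (\<Prod>j<n. \<mu> (\<iota> j))"
      by (intro mult_left_le) (simp_all add: prod_norm)
    then show "infsum (\<lambda>\<kappa>. norm (g \<pi> \<iota> \<kappa>)) PE \<le> norm (\<Prod>j<n. \<mu> (\<iota> j))"
      unfolding g_alt[OF \<pi>] norm_mult[of "\<Prod>j<n. \<mu> (\<iota> j)"] by (subst infsum_cmult_right') 
  qed

  have \<mu>_abs: "(\<lambda>\<iota>. \<Prod>j<n. \<mu> (\<iota> j)) abs_summable_on PI"
    unfolding PI_def using \<mu> by (intro abs_summable_on_prod_PiE) auto
  \<comment> \<open>Tonelli: the inner absolute sums are at most the modulus of the product of the
    \<open>\<mu> (\<iota> j)\<close>, which is summable over \<open>\<iota>\<close>.\<close>
  have g_summable: "(\<lambda>(\<iota>, \<kappa>). g \<pi> \<iota> \<kappa>) summable_on PI \<times> PE" if \<pi>: "\<pi> permutes {..<n}" for \<pi>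
  proof (rule abs_summable_summable, subst Infinite_Sum.abs_summable_on_Sigma_iff, intro conjI ballI)
    show "(\<lambda>\<kappa>. case (\<iota>, \<kappa>) of (\<iota>, \<kappa>) \<Rightarrow> g \<pi> \<iota> \<kappa>) abs_summable_on PE" if "\<iota> \<in> PI" for \<iota>
      using inner(2)[OF \<pi> that] by simp
    show "(\<lambda>\<iota>. \<Sum>\<^sub>\<infinity>\<kappa>\<in>PE. norm (case (\<iota>, \<kappa>) of (\<iota>, \<kappa>) \<Rightarrow> g \<pi> \<iota> \<kappa>)) abs_summable_on PI"
      by (rule Infinite_Sum.abs_summable_on_comparison_test[OF \<mu>_abs])
         (use inner(3)[OF \<pi>] in \<open>auto simp: infsum_nonneg\<close>)
  qed
  define A where "A \<pi> = infsum (\<lambda>(\<iota>, \<kappa>). g \<pi> \<iota> \<kappa>) (PI \<times> PE)" for \<pi>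
  have gA: "((\<lambda>(\<iota>, \<kappa>). g \<pi> \<iota> \<kappa>) has_sum A \<pi>) (PI \<times> PE)" if "\<pi> permutes {..<n}" for \<pi>
    unfolding A_def using g_summable[OF that] by simp
  have sumI: "((\<lambda>\<iota>. (\<Prod>j<n. \<mu> (\<iota> j)) * (\<Prod>j<n. \<delta> (\<iota> j) (\<iota> (\<pi> j)))) has_sum A \<pi>) PI"
    if \<pi>: "\<pi> permutes {..<n}" for \<pi>
    by (rule has_sum_Sigma'[OF gA[OF \<pi>]]) (use inner(1)[OF \<pi>] in auto)
  \<comment> \<open>In the opposite order each \<open>\<iota> j\<close> occurs in one factor of the
    original form of \<open>g\<close>, and the factors sum to matrix entries.\<close>
  have sumE: "((\<lambda>\<kappa>. \<Prod>j<n. M (\<kappa> j) (\<kappa> (\<pi> j))) has_sum A \<pi>) PE" if \<pi>: "\<pi> permutes {..<n}" for \<pi>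
  proof (rule has_sum_Sigma'[OF gA[OF \<pi>, THEN has_sum_swap[THEN iffD1]]])
    fix \<kappa> assume \<kappa>: "\<kappa> \<in> PE"
    have \<kappa>E: "\<kappa> j \<in> E" "\<kappa> (\<pi> j) \<in> E" if "j < n" for j
      using \<kappa> that permutes_in_image[OF \<pi>, of j] by (auto simp: PE_def)
    show "((\<lambda>\<iota>. case (\<kappa>, \<iota>) of (x, y) \<Rightarrow> case (y, x) of (\<iota>, \<kappa>) \<Rightarrow> g \<pi> \<iota> \<kappa>) has_sum
        (\<Prod>j<n. M (\<kappa> j) (\<kappa> (\<pi> j)))) PI"
      unfolding g_def PI_def prod.case
      by (rule has_sum_prod_PiE) (auto intro!: M_abs M \<kappa>E)
  qed
  define t where "t = (\<Sum>\<pi>\<in>?P. of_int (sign \<pi>) * A \<pi>)"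
  have "((\<lambda>\<kappa>. \<Sum>\<pi>\<in>?P. of_int (sign \<pi>) * (\<Prod>j<n. M (\<kappa> j) (\<kappa> (\<pi> j)))) has_sum t) PE"
    unfolding t_def by (intro has_sum_sum has_sum_cmult_right sumE) (auto intro: finite_permutations)
  then have detE: "((\<lambda>\<kappa>. det_on {..<n} (\<lambda>i j. M (\<kappa> i) (\<kappa> j))) has_sum t) PE"
    by (simp add: det_on_def)
  have "((\<lambda>\<iota>. \<Sum>\<pi>\<in>?P. of_int (sign \<pi>) * ((\<Prod>j<n. \<mu> (\<iota> j)) * (\<Prod>j<n. \<delta> (\<iota> j) (\<iota> (\<pi> j))))) has_sum t) PI"
    unfolding t_def by (intro has_sum_sum has_sum_cmult_right sumI) (auto intro: finite_permutations)
  then have detI: "((\<lambda>\<iota>. (\<Prod>j<n. \<mu> (\<iota> j)) * det_on {..<n} (\<lambda>i j. \<delta> (\<iota> i) (\<iota> j))) has_sum t) PI"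
    by (simp add: det_on_def sum_distrib_left mult.left_commute)

  \<comment> \<open>A repeated entry of the tuple produces two equal rows, so only injective tuples
    survive.\<close>
  have "det_on {..<n} (\<lambda>i j. M (\<kappa> i) (\<kappa> j)) = (if inj_on \<kappa> {..<n} then det_on (\<kappa> ` {..<n}) M else 0)" for \<kappa>
  proof (cases "inj_on \<kappa> {..<n}")
    case False
    then obtain i j where "i \<in> {..<n}" "j \<in> {..<n}" "i \<noteq> j" "\<kappa> i = \<kappa> j"
      by (auto simp: inj_on_def)
    then show ?thesis
      using False det_on_identical_rows[of "{..<n}" i j] by auto
  qed (simp add: det_on_image)
  then have E: "((\<lambda>S. det_on S M) has_sum (t / of_nat (\<Prod>i<n. n - i))) {S. S \<subseteq> E \<and> finite S \<and> card S = n}"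
    using detE by (intro has_sum_card_subsets) (simp add: PE_def)

  have "(\<Prod>j<n. \<mu> (\<iota> j)) * det_on {..<n} (\<lambda>i j. \<delta> (\<iota> i) (\<iota> j)) =
      (if inj_on \<iota> {..<n} then \<Prod>i\<in>\<iota> ` {..<n}. \<mu> i else 0)" for \<iota>
  proof (cases "inj_on \<iota> {..<n}")
    case False
    then obtain i j where "i \<in> {..<n}" "j \<in> {..<n}" "i \<noteq> j" "\<iota> i = \<iota> j"
      by (auto simp: inj_on_def)
    then have "det_on {..<n} (\<lambda>i j. \<delta> (\<iota> i) (\<iota> j)) = 0"
      using det_on_identical_rows[of "{..<n}" i j] by auto
    then show ?thesis
      using False by simp
  next
    case True
    have "det_on {..<n} (\<lambda>i j. \<delta> (\<iota> i) (\<iota> j)) = (\<Sum>\<pi>\<in>?P. if \<pi> = id then 1 else 0)"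
      unfolding det_on_def
    proof (rule sum.cong[OF refl])
      fix \<pi> assume "\<pi> \<in> ?P"
      then have \<pi>: "\<pi> permutes {..<n}"
        by simp
      show "of_int (sign \<pi>) * (\<Prod>j<n. \<delta> (\<iota> j) (\<iota> (\<pi> j))) = (if \<pi> = id then 1 else 0)"
      proof (cases "\<pi> = id")
        case False
        then obtain j where j: "\<pi> j \<noteq> j"
          by (auto simp: fun_eq_iff)
        then have "j < n"
          using permutes_not_in[OF \<pi>, of j] by force
        then have "\<delta> (\<iota> j) (\<iota> (\<pi> j)) = 0"
          using True j permutes_in_image[OF \<pi>, of j] by (auto simp: \<delta>_def inj_on_def)
        then show ?thesis
          using False \<open>j < n\<close> by (auto intro!: prod_zero)
      qed (simp add: \<delta>_def)
    qed
    also have "\<dots> = 1"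
      by (simp add: sum.delta finite_permutations permutes_id)
    finally show ?thesis
      using True by (simp add: prod.reindex)
  qed
  then have I: "((\<lambda>J. \<Prod>i\<in>J. \<mu> i) has_sum (t / of_nat (\<Prod>i<n. n - i))) {J. J \<subseteq> I \<and> finite J \<and> card J = n}"
    using detI by (intro has_sum_card_subsets) (simp add: PI_def)
  \<comment> \<open>The same \<open>t\<close>, divided by the same n!, was obtained over
    \<open>E\<close> and over \<open>I\<close>.\<close>
  show ?thesis
    using E infsumI[OF I] by simp
qed


section \<open>Square-summable families and Parseval\<close>

lemma has_sum_diff:
  fixes f g :: "'a \<Rightarrow> 'b::topological_ab_group_add"
  assumes "(f has_sum a) A" "(g has_sum b) A"
  shows "((\<lambda>x. f x - g x) has_sum (a - b)) A"
  using has_sum_add[OF assms(1), of "\<lambda>x. - g x" "- b"] assms(2) by (simp add: has_sum_uminus)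

definition l2 :: "('i \<Rightarrow> complex) \<Rightarrow> bool" where
  "l2 a \<longleftrightarrow> (\<lambda>i. (cmod (a i))\<^sup>2) summable_on UNIV"

definition l2_inner :: "('i \<Rightarrow> complex) \<Rightarrow> ('i \<Rightarrow> complex) \<Rightarrow> complex" where
  "l2_inner a b = (\<Sum>\<^sub>\<infinity>i. a i * cnj (b i))"

definition l2_sqnorm :: "('i \<Rightarrow> complex) \<Rightarrow> real" where
  "l2_sqnorm a = (\<Sum>\<^sub>\<infinity>i. (cmod (a i))\<^sup>2)"

lemma l2_has_sum: "l2 a \<Longrightarrow> ((\<lambda>i. (cmod (a i))\<^sup>2) has_sum l2_sqnorm a) UNIV"
  by (simp add: l2_def l2_sqnorm_def)

lemma l2_sqnorm_nonneg: "0 \<le> l2_sqnorm a"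
  by (simp add: l2_sqnorm_def infsum_nonneg)

lemma l2_inner_abs_summable:
  assumes "l2 a" "l2 b"
  shows "(\<lambda>i. a i * cnj (b i)) abs_summable_on UNIV"
proof (rule Infinite_Sum.abs_summable_on_comparison_test')
  show "(\<lambda>i. (cmod (a i))\<^sup>2 + (cmod (b i))\<^sup>2) summable_on UNIV"
    using assms by (intro summable_on_add) (auto simp: l2_def)
  fix i
  have "2 * (cmod (a i) * cmod (b i)) \<le> (cmod (a i))\<^sup>2 + (cmod (b i))\<^sup>2"
    using sum_squares_bound[of "cmod (a i)" "cmod (b i)"] by (simp add: mult.assoc)
  moreover have "0 \<le> cmod (a i) * cmod (b i)"
    by simp
  ultimately show "norm (a i * cnj (b i)) \<le> (cmod (a i))\<^sup>2 + (cmod (b i))\<^sup>2"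
    by (simp only: norm_mult complex_mod_cnj)
qed

lemma l2_inner_has_sum:
  "l2 a \<Longrightarrow> l2 b \<Longrightarrow> ((\<lambda>i. a i * cnj (b i)) has_sum l2_inner a b) UNIV"
  unfolding l2_inner_def by (rule has_sum_infsum[OF abs_summable_summable[OF l2_inner_abs_summable]])

lemma l2_inner_self:
  assumes "l2 a"
  shows "l2_inner a a = of_real (l2_sqnorm a)"
  unfolding l2_inner_def
  using has_sum_of_real[OF l2_has_sum[OF assms], where ?'a = complex]
  by (intro infsumI) (simp add: complex_norm_square del: of_real_power)

lemma l2_cmult: "l2 a \<Longrightarrow> l2 (\<lambda>i. c * a i)"
  unfolding l2_def by (simp add: norm_mult power_mult_distrib summable_on_cmult_right)

lemma l2_diff:
  assumes "l2 a" "l2 b"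
  shows "l2 (\<lambda>i. a i - b i)"
proof -
  have "(\<lambda>i. (cmod (a i - b i))\<^sup>2) abs_summable_on UNIV"
  proof (rule Infinite_Sum.abs_summable_on_comparison_test')
    show "(\<lambda>i. 2 * (cmod (a i))\<^sup>2 + 2 * (cmod (b i))\<^sup>2) summable_on UNIV"
      using assms by (intro summable_on_add summable_on_cmult_right) (auto simp: l2_def)
    fix i
    have "(cmod (a i - b i))\<^sup>2 \<le> (cmod (a i) + cmod (b i))\<^sup>2"
      by (intro power_mono norm_triangle_ineq4) auto
    also have "\<dots> \<le> 2 * (cmod (a i))\<^sup>2 + 2 * (cmod (b i))\<^sup>2"
      using sum_squares_bound[of "cmod (a i)" "cmod (b i)"] by (simp add: power2_sum)
    finally show "norm ((cmod (a i - b i))\<^sup>2) \<le> 2 * (cmod (a i))\<^sup>2 + 2 * (cmod (b i))\<^sup>2"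
      by simp
  qed
  then show ?thesis
    by (simp add: l2_def)
qed

lemma l2_finite_support: "finite {i. a i \<noteq> 0} \<Longrightarrow> l2 a"
  unfolding l2_def by (rule finite_nonzero_values_imp_summable_on) simp

lemma l2_inner_diff_cmult_left:
  assumes "l2 a" "l2 b" "l2 d"
  shows "l2_inner (\<lambda>i. a i - c * b i) d = l2_inner a d - c * l2_inner b d"
proof -
  have "((\<lambda>i. a i * cnj (d i) - c * (b i * cnj (d i))) has_sum l2_inner a d - c * l2_inner b d) UNIV"
    using assms by (intro has_sum_diff has_sum_cmult_right l2_inner_has_sum)
  then show ?thesis
    unfolding l2_inner_def by (intro infsumI) (simp add: algebra_simps)
qed

lemma l2_sqnorm_diff_cmult:
  assumes "l2 y" "l2 u"
  shows "l2_sqnorm (\<lambda>i. y i - c * u i) =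
    l2_sqnorm y + (cmod c)\<^sup>2 * l2_sqnorm u - 2 * Re (cnj c * l2_inner y u)"
proof -
  have "((\<lambda>i. (cmod (y i))\<^sup>2 + (cmod c)\<^sup>2 * (cmod (u i))\<^sup>2 - 2 * Re (cnj c * (y i * cnj (u i)))) has_sum
      l2_sqnorm y + (cmod c)\<^sup>2 * l2_sqnorm u - 2 * Re (cnj c * l2_inner y u)) UNIV"
    using assms
    by (intro has_sum_diff has_sum_add has_sum_cmult_right has_sum_Re l2_has_sum l2_inner_has_sum)
  moreover have "(cmod (y i))\<^sup>2 + (cmod c)\<^sup>2 * (cmod (u i))\<^sup>2 - 2 * Re (cnj c * (y i * cnj (u i)))
      = (cmod (y i - c * u i))\<^sup>2" for i
    unfolding cmod_power2 by (simp add: power2_eq_square algebra_simps)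
  ultimately show ?thesis
    unfolding l2_sqnorm_def by (intro infsumI) simp
qed

text \<open>Completing the square, one vector of \<open>S\<close> at a time. The second claim feeds
  the induction for the third: subtracting earlier vectors leaves the next Fourier coefficient
  unchanged.\<close>

lemma l2_sqnorm_diff_orthonormal:
  assumes U: "\<And>e. e \<in> E \<Longrightarrow> l2 (U e)" and x: "l2 x"
    and ortho: "\<And>e f. e \<in> E \<Longrightarrow> f \<in> E \<Longrightarrow> l2_inner (U e) (U f) = (if e = f then 1 else 0)"
    and "finite S" "S \<subseteq> E"
  shows "l2 (\<lambda>i. x i - (\<Sum>e\<in>S. c e * U e i))"
    and "f \<in> E - S \<Longrightarrow> l2_inner (\<lambda>i. x i - (\<Sum>e\<in>S. c e * U e i)) (U f) = l2_inner x (U f)"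
    and "l2_sqnorm (\<lambda>i. x i - (\<Sum>e\<in>S. c e * U e i)) =
      l2_sqnorm x + (\<Sum>e\<in>S. (cmod (c e - l2_inner x (U e)))\<^sup>2 - (cmod (l2_inner x (U e)))\<^sup>2)"
  using assms(4,5)
proof (induction S arbitrary: f rule: finite_induct)
  case empty
  { case 1 then show ?case using x by simp }
  { case 2 then show ?case by simp }
  { case 3 then show ?case by simp }
next
  case (insert e S)
  let ?y = "\<lambda>i. x i - (\<Sum>e\<in>S. c e * U e i)"
  have eq: "(\<lambda>i. x i - (\<Sum>e\<in>insert e S. c e * U e i)) = (\<lambda>i. ?y i - c e * U e i)"
    using insert.hyps by (simp add: algebra_simps)
  { case 1
    then have "l2 ?y" "l2 (U e)"
      using insert.IH(1) U by auto
    then show ?case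
      unfolding eq by (rule l2_diff[OF _ l2_cmult]) }
  { case 2
    then show ?case
      unfolding eq using insert U ortho by (subst l2_inner_diff_cmult_left) auto }
  { case 3
    have "complex_of_real (l2_sqnorm (U e)) = l2_inner (U e) (U e)"
      using l2_inner_self[OF U[of e]] 3 by simp
    then have "l2_sqnorm (U e) = 1"
      using ortho[of e e] 3 by (metis insert_subset of_real_eq_1_iff)
    moreover have "(cmod (c e))\<^sup>2 - 2 * Re (cnj (c e) * l2_inner x (U e)) =
        (cmod (c e - l2_inner x (U e)))\<^sup>2 - (cmod (l2_inner x (U e)))\<^sup>2"
      unfolding cmod_power2 by (simp add: power2_eq_square algebra_simps)
    ultimately show ?case
      unfolding eq using insert 3 U by (subst l2_sqnorm_diff_cmult) (auto simp: algebra_simps) }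
qed

text \<open>With Fourier coefficients as \<open>c\<close>, the completed square gives Bessel's
  inequality. With the coefficients of an approximant of squared error below
  \<open>\<epsilon>\<close>, it shows that the Bessel sum misses less than
  \<open>\<epsilon>\<close>.\<close>

lemma l2_parseval:
  assumes U: "\<And>e. e \<in> E \<Longrightarrow> l2 (U e)" and x: "l2 x"
    and ortho: "\<And>e f. e \<in> E \<Longrightarrow> f \<in> E \<Longrightarrow> l2_inner (U e) (U f) = (if e = f then 1 else 0)"
    and dense: "\<And>\<epsilon>. \<epsilon> > 0 \<Longrightarrow>
      \<exists>S c. finite S \<and> S \<subseteq> E \<and> l2_sqnorm (\<lambda>i. x i - (\<Sum>e\<in>S. c e * U e i)) < \<epsilon>"
  shows "((\<lambda>e. (cmod (l2_inner x (U e)))\<^sup>2) has_sum l2_sqnorm x) E"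
proof -
  let ?p = "\<lambda>e. (cmod (l2_inner x (U e)))\<^sup>2"
  have bessel: "sum ?p S \<le> l2_sqnorm x" if "finite S" "S \<subseteq> E" for S
    using l2_sqnorm_diff_orthonormal(3)[OF U x ortho that, of "\<lambda>e. l2_inner x (U e)"]
      l2_sqnorm_nonneg[of "\<lambda>i. x i - (\<Sum>e\<in>S. l2_inner x (U e) * U e i)"]
    by (simp add: sum_negf)
  show ?thesis
    unfolding has_sum_def tendsto_iff eventually_finite_subsets_at_top
  proof (intro allI impI)
    fix \<epsilon> :: real assume "\<epsilon> > 0"
    then obtain S c where S: "finite S" "S \<subseteq> E"
      and less: "l2_sqnorm (\<lambda>i. x i - (\<Sum>e\<in>S. c e * U e i)) < \<epsilon>"
      using dense by blast
    have "l2_sqnorm x - \<epsilon> < sum ?p S"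
      using l2_sqnorm_diff_orthonormal(3)[OF U x ortho S, of c] less
        sum_nonneg[of S "\<lambda>e. (cmod (c e - l2_inner x (U e)))\<^sup>2"]
      by (simp add: sum_subtractf)
    moreover have "sum ?p S \<le> sum ?p T" if "finite T" "S \<subseteq> T" for T
      using that by (intro sum_mono2) auto
    ultimately have "dist (sum ?p T) (l2_sqnorm x) < \<epsilon>" if "finite T" "S \<subseteq> T" "T \<subseteq> E" for T
      using bessel[of T] that \<open>\<epsilon> > 0\<close> by (force simp: dist_real_def abs_less_iff)
    then show "\<exists>S. finite S \<and> S \<subseteq> E \<and>
        (\<forall>T. finite T \<and> S \<subseteq> T \<and> T \<subseteq> E \<longrightarrow> dist (sum ?p T) (l2_sqnorm x) < \<epsilon>)"
      using S by blast
  qed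
qed

text \<open>Parseval for \<open>\<delta>\<^sub>i + \<omega> \<delta>\<^sub>j\<close> with \<open>\<omega> = 1\<close> and \<open>\<omega> = \<i>\<close>.\<close>

lemma l2_basis_columns_orthonormal:
  fixes U :: "'e \<Rightarrow> 'i \<Rightarrow> complex"
  assumes U: "\<And>e. e \<in> E \<Longrightarrow> l2 (U e)"
    and ortho: "\<And>e f. e \<in> E \<Longrightarrow> f \<in> E \<Longrightarrow> l2_inner (U e) (U f) = (if e = f then 1 else 0)"
    and dense: "\<And>x \<epsilon>. l2 x \<Longrightarrow> \<epsilon> > 0 \<Longrightarrow>
      \<exists>S c. finite S \<and> S \<subseteq> E \<and> l2_sqnorm (\<lambda>i. x i - (\<Sum>e\<in>S. c e * U e i)) < \<epsilon>"
  shows "((\<lambda>e. U e i * cnj (U e j)) has_sum (if i = j then 1 else 0)) E"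
proof -
  have one: "((\<lambda>e. (cmod (U e i))\<^sup>2) has_sum 1) E" for i
  proof -
    let ?x = "\<lambda>k. if k = i then 1 else 0"
    have "l2_sqnorm ?x = 1"
      unfolding l2_sqnorm_def by (rule infsumI, rule has_sum_finite_neutralI[of "{i}"]) auto
    moreover have "l2_inner ?x (U e) = cnj (U e i)" for e
      unfolding l2_inner_def by (rule infsumI, rule has_sum_finite_neutralI[of "{i}"]) auto
    moreover have "l2 ?x"
      by (rule l2_finite_support) auto
    ultimately show ?thesis
      using l2_parseval[of E U ?x, OF U _ ortho dense] by simp
  qed
  show ?thesis
  proof (cases "i = j")
    case True
    then show ?thesis
      using has_sum_of_real[OF one[of i], where ?'a = complex]
      by (simp add: complex_norm_square del: of_real_power)
  next
    case False
    have two: "((\<lambda>e. (cmod (cnj (U e i) + \<omega> * cnj (U e j)))\<^sup>2) has_sum 2) E" if "cmod \<omega> = 1" for \<omega>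
    proof -
      let ?x = "\<lambda>k. if k = i then 1 else if k = j then \<omega> else 0"
      have "l2_sqnorm ?x = 2"
        unfolding l2_sqnorm_def
        by (rule infsumI, rule has_sum_finite_neutralI[of "{i, j}"]) (use False that in auto)
      moreover have "l2_inner ?x (U e) = cnj (U e i) + \<omega> * cnj (U e j)" for e
        unfolding l2_inner_def
        by (rule infsumI, rule has_sum_finite_neutralI[of "{i, j}"]) (use False in auto)
      moreover have "l2 ?x"
        by (rule l2_finite_support, rule finite_subset[of _ "{i, j}"]) auto
      ultimately show ?thesis
        using l2_parseval[of E U ?x, OF U _ ortho dense] by simp
    qed
    have "((\<lambda>e. ((cmod (cnj (U e i) + 1 * cnj (U e j)))\<^sup>2 - (cmod (U e i))\<^sup>2 - (cmod (U e j))\<^sup>2) / 2)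
        has_sum (2 - 1 - 1) / 2) E"
      by (intro has_sum_divide_const has_sum_diff two one) simp
    then have Re: "((\<lambda>e. Re (U e i * cnj (U e j))) has_sum 0) E"
      unfolding cmod_power2 by (simp add: power2_eq_square algebra_simps add_divide_distrib diff_divide_distrib)
    \<comment> \<open>For \<open>\<omega> = \<i>\<close> the cross term is minus twice the imaginary
      part, hence the reversed subtraction compared with the real part.\<close>
    have "((\<lambda>e. ((cmod (U e i))\<^sup>2 + (cmod (U e j))\<^sup>2 - (cmod (cnj (U e i) + \<i> * cnj (U e j)))\<^sup>2) / 2)
        has_sum (1 + 1 - 2) / 2) E"
      by (intro has_sum_divide_const has_sum_diff has_sum_add two one) simp
    then have Im: "((\<lambda>e. Im (U e i * cnj (U e j))) has_sum 0) E"
      unfolding cmod_power2 by (simp add: power2_eq_square algebra_simps add_divide_distrib diff_divide_distrib)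
    have "((\<lambda>e. complex_of_real (Re (U e i * cnj (U e j))) + \<i> * complex_of_real (Im (U e i * cnj (U e j))))
        has_sum complex_of_real 0 + \<i> * complex_of_real 0) E"
      by (intro has_sum_add has_sum_cmult_right has_sum_of_real Re Im)
    then show ?thesis
      using False by (simp only: complex_eq[symmetric]) simp
  qed
qed


section \<open>Hardy spaces in coordinates\<close>

text \<open>Inverse of \<open>mcoeff l\<close> on \<open>Sym l\<close>; it supplies the polynomial
  witnesses that \<open>hardy_sum\<close> asks for.\<close>

definition sympoly :: "nat \<Rightarrow> (nat \<Rightarrow> complex) \<Rightarrow> complex poly poly" where
  "sympoly l c = (\<Sum>k\<le>2*l. monom (monom (c k) (2*l - k)) k)"

lemma coeff_sympoly: "coeff (sympoly l c) k = (if k \<le> 2*l then monom (c k) (2*l - k) else 0)"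
  by (simp add: sympoly_def coeff_sum sum.delta)

lemma sympoly_in_Sym: "sympoly l c \<in> Sym l"
  by (auto simp: Sym_def coeff_sympoly split: if_splits)

lemma mcoeff_sympoly: "k \<le> 2*l \<Longrightarrow> mcoeff l (sympoly l c) k = c k"
  by (simp add: mcoeff_def coeff_sympoly)

text \<open>Truncated subtraction makes the exponent of the first variable 0 here, and the monomial
  left has degree \<open>k\<close>, different from \<open>2*l\<close>.\<close>

lemma mcoeff_eq_0: "p \<in> Sym l \<Longrightarrow> 2*l < k \<Longrightarrow> mcoeff l p k = 0"
  by (force simp: Sym_def mcoeff_def)

lemma sympoly_mcoeff: "p \<in> Sym l \<Longrightarrow> sympoly l (mcoeff l p) = p"
  unfolding poly_eq_iff coeff_sympoly by (force simp: Sym_def mcoeff_def)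

lemma mcoeff_cscale [simp]: "mcoeff l (cscale c p) k = c * mcoeff l p k"
  by (simp add: mcoeff_def cscale_def)

lemma mcoeff_0 [simp]: "mcoeff l 0 k = 0"
  by (simp add: mcoeff_def)

lemma zero_in_Sym [simp]: "0 \<in> Sym l"
  by (simp add: Sym_def)

lemma tensor_in_tensor_space:
  assumes "p \<in> Sym l" "q \<in> Sym l"
  shows "tensor l p (cscale c q) \<in> tensor_space l"
  using mcoeff_eq_0[OF assms(1)] mcoeff_eq_0[OF assms(2)]
  by (auto simp: tensor_space_def tensor_def not_less[symmetric])

definition sym_sqnorm :: "nat \<Rightarrow> complex poly poly \<Rightarrow> real" where
  "sym_sqnorm l p = (\<Sum>k\<le>2*l. (cmod (mcoeff l p k))\<^sup>2 / real ((2*l) choose k))"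

lemma sym_inner_self: "sym_inner l p p = of_real (sym_sqnorm l p)"
  by (simp add: sym_inner_def sym_sqnorm_def complex_norm_square del: of_real_power)

lemma Re_tensor_inner_self:
  "Re (tensor_inner l A A) =
    (\<Sum>k\<le>2*l. (\<Sum>j\<le>2*l. (cmod (A k j))\<^sup>2 / real ((2*l) choose j)) / real ((2*l) choose k))"
proof -
  have "tensor_inner l A A = of_real (\<Sum>k\<le>2*l. (\<Sum>j\<le>2*l. (cmod (A k j))\<^sup>2 / real ((2*l) choose j)) / real ((2*l) choose k))"
    by (simp add: tensor_inner_def complex_norm_square sum_divide_distrib mult.commute del: of_real_power)
  then show ?thesis
    by simp
qed

text \<open>Against a pure tensor, \<open>A\<close> enters only through the pairings of its rows
  with \<open>q\<close>; this reduces the projection onto a Hardy sum to one-dimensional projections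
  of rows.\<close>

lemma tensor_inner_row_sums:
  "tensor_inner l A (tensor l p (cscale c q)) =
    (\<Sum>k\<le>2*l. cnj (mcoeff l p k * c) / of_nat ((2*l) choose k) *
      (\<Sum>j\<le>2*l. A k j * cnj (mcoeff l q j) / of_nat ((2*l) choose j)))"
  by (simp add: tensor_inner_def tensor_def sum_distrib_left mult_ac)

lemma weighted_cauchy_schwarz:
  "(cmod (\<Sum>j\<le>2*l. a j * cnj (b j) / of_nat ((2*l) choose j)))\<^sup>2 \<le>
    (\<Sum>j\<le>2*l. (cmod (a j))\<^sup>2 / real ((2*l) choose j)) * (\<Sum>j\<le>2*l. (cmod (b j))\<^sup>2 / real ((2*l) choose j))"
proof -
  let ?r = "\<lambda>j. sqrt (real ((2*l) choose j))"
  have "cmod (\<Sum>j\<le>2*l. a j * cnj (b j) / of_nat ((2*l) choose j)) \<le>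
      (\<Sum>j\<le>2*l. (cmod (a j) / ?r j) * (cmod (b j) / ?r j))"
    by (rule order_trans[OF norm_sum]) (simp add: norm_mult norm_divide)
  then have "(cmod (\<Sum>j\<le>2*l. a j * cnj (b j) / of_nat ((2*l) choose j)))\<^sup>2 \<le>
      (\<Sum>j\<le>2*l. (cmod (a j) / ?r j) * (cmod (b j) / ?r j))\<^sup>2"
    by (intro power_mono) auto
  also have "\<dots> \<le> (\<Sum>j\<le>2*l. (cmod (a j) / ?r j)\<^sup>2) * (\<Sum>j\<le>2*l. (cmod (b j) / ?r j)\<^sup>2)"
    by (rule Cauchy_Schwarz_ineq_sum)
  finally show ?thesis
    by (simp add: power_divide)
qed

section \<open>Orthogonal projections onto the Hardy sums\<close>

text \<open>Row \<open>k\<close> of \<open>f l\<close> is a vector of the second tensor factor; this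
  is the coefficient of its orthogonal projection onto the line through \<open>v l\<close>.\<close>

definition row_proj :: "(nat \<Rightarrow> complex poly poly) \<Rightarrow> pw \<Rightarrow> nat \<Rightarrow> nat \<Rightarrow> complex" where
  "row_proj v f l k =
    (\<Sum>j\<le>2*l. f l k j * cnj (mcoeff l (v l) j) / of_nat ((2*l) choose j)) / of_real (sym_sqnorm l (v l))"

definition hardy_proj :: "(nat \<Rightarrow> complex poly poly) \<Rightarrow> pw \<Rightarrow> pw" where
  "hardy_proj v f = (\<lambda>l k j. row_proj v f l k * mcoeff l (v l) j)"

context
  fixes v :: "nat \<Rightarrow> complex poly poly"
  assumes v_Sym: "\<And>l. v l \<in> Sym l" and v_pos: "\<And>l. sym_sqnorm l (v l) > 0"
begin

lemma hardy_sumI: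
  assumes p: "\<And>l. p l \<in> Sym l" and f: "\<And>l. f l = tensor l (p l) (cscale 1 (v l))"
    and "summable (\<lambda>l. Re (tensor_inner l (f l) (f l)))"
  shows "f \<in> hardy_sum v"
proof -
  have "f l \<in> tensor_space l" for l
    unfolding f by (rule tensor_in_tensor_space[OF p v_Sym])
  then show ?thesis
    unfolding hardy_sum_def pw_space_def using p f assms(3) by blast
qed

text \<open>Cauchy-Schwarz in each row shows that projecting does not increase the norm, so
  square-summability is inherited from \<open>f\<close>.\<close>

lemma hardy_proj_in_hardy_sum:
  assumes f: "f \<in> pw_space"
  shows "hardy_proj v f \<in> hardy_sum v"
proof -
  have f0: "f l k j = 0" if "2*l < k" for l k j
    using f that by (force simp: pw_space_def tensor_space_def)
  have tensor: "hardy_proj v f l = tensor l (sympoly l (row_proj v f l)) (cscale 1 (v l))" for l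
  proof (intro ext)
    fix k j
    show "hardy_proj v f l k j = tensor l (sympoly l (row_proj v f l)) (cscale 1 (v l)) k j"
    proof (cases "k \<le> 2*l")
      case True
      then show ?thesis
        by (simp add: hardy_proj_def tensor_def mcoeff_sympoly)
    next
      case False
      then show ?thesis
        by (simp add: hardy_proj_def tensor_def mcoeff_eq_0[OF sympoly_in_Sym] row_proj_def f0)
    qed
  qed
  have le: "Re (tensor_inner l (hardy_proj v f l) (hardy_proj v f l)) \<le> Re (tensor_inner l (f l) (f l))" for l
    unfolding Re_tensor_inner_self
  proof (rule sum_mono, rule divide_right_mono)
    fix k
    let ?N = "sym_sqnorm l (v l)"
    let ?s = "\<Sum>j\<le>2*l. f l k j * cnj (mcoeff l (v l) j) / of_nat ((2*l) choose j)"
    have "(\<Sum>j\<le>2*l. (cmod (hardy_proj v f l k j))\<^sup>2 / real ((2*l) choose j)) = (cmod (row_proj v f l k))\<^sup>2 * ?N"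
      by (simp add: hardy_proj_def norm_mult power_mult_distrib sym_sqnorm_def sum_distrib_left)
    also have "\<dots> = (cmod ?s)\<^sup>2 / ?N"
      using v_pos[of l] by (simp add: row_proj_def norm_divide power_divide power2_eq_square)
    also have "\<dots> \<le> (\<Sum>j\<le>2*l. (cmod (f l k j))\<^sup>2 / real ((2*l) choose j))"
      using weighted_cauchy_schwarz[where l = l and a = "f l k" and b = "mcoeff l (v l)"] v_pos[of l]
      by (simp add: divide_le_eq sym_sqnorm_def)
    finally show "(\<Sum>j\<le>2*l. (cmod (hardy_proj v f l k j))\<^sup>2 / real ((2*l) choose j))
        \<le> (\<Sum>j\<le>2*l. (cmod (f l k j))\<^sup>2 / real ((2*l) choose j))" .
  qed simp
  have nonneg: "0 \<le> Re (tensor_inner l (hardy_proj v f l) (hardy_proj v f l))" for l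
    unfolding Re_tensor_inner_self by (intro sum_nonneg divide_nonneg_nonneg) auto
  have "summable (\<lambda>l. Re (tensor_inner l (hardy_proj v f l) (hardy_proj v f l)))"
  proof (rule summable_comparison_test')
    show "summable (\<lambda>l. Re (tensor_inner l (f l) (f l)))"
      using f by (simp add: pw_space_def)
    show "norm (Re (tensor_inner l (hardy_proj v f l) (hardy_proj v f l))) \<le> Re (tensor_inner l (f l) (f l))"
      if "l \<ge> 0" for l
      using le[of l] nonneg[of l] by (simp only: real_norm_def abs_of_nonneg)
  qed
  then show ?thesis
    using hardy_sumI[OF sympoly_in_Sym tensor] by blast
qed

lemma row_sum_hardy_proj:
  "(\<Sum>j\<le>2*l. hardy_proj v f l k j * cnj (mcoeff l (v l) j) / of_nat ((2*l) choose j)) =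
   (\<Sum>j\<le>2*l. f l k j * cnj (mcoeff l (v l) j) / of_nat ((2*l) choose j))"
proof -
  have "(\<Sum>j\<le>2*l. hardy_proj v f l k j * cnj (mcoeff l (v l) j) / of_nat ((2*l) choose j)) =
      row_proj v f l k * sym_inner l (v l) (v l)"
    by (simp add: hardy_proj_def sym_inner_def sum_distrib_left mult.assoc)
  also have "\<dots> = (\<Sum>j\<le>2*l. f l k j * cnj (mcoeff l (v l) j) / of_nat ((2*l) choose j))"
    using v_pos[of l] unfolding sym_inner_self by (simp add: row_proj_def)
  finally show ?thesis .
qed

lemma orth_proj_hardy_sum:
  assumes f: "f \<in> pw_space"
  shows "orth_proj (hardy_sum v) f = hardy_proj v f"
  unfolding orth_proj_def
proof (rule the_equality, intro conjI ballI)
  show "hardy_proj v f \<in> hardy_sum v"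
    by (rule hardy_proj_in_hardy_sum[OF f])
next
  fix m assume "m \<in> hardy_sum v"
  then have m: "\<forall>l. \<exists>p\<in>Sym l. \<exists>c. m l = tensor l p (cscale c (v l))"
    by (simp add: hardy_sum_def)
  have "tensor_inner l ((f - hardy_proj v f) l) (m l) = 0" for l
  proof -
    obtain p c where "m l = tensor l p (cscale c (v l))"
      using m by blast
    then show ?thesis
      using row_sum_hardy_proj[of f l]
      by (simp add: tensor_inner_row_sums left_diff_distrib diff_divide_distrib sum_subtractf)
  qed
  then show "pw_inner (f - hardy_proj v f) m = 0"
    by (simp add: pw_inner_def)
next
  fix g assume g: "g \<in> hardy_sum v \<and> (\<forall>m\<in>hardy_sum v. pw_inner (f - g) m = 0)"
  show "g = hardy_proj v f"
  proof (intro ext)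
    fix l k j
    have f0: "f l k j = 0" if "2*l < k" for j
      using f that by (force simp: pw_space_def tensor_space_def)
    have g0: "g l k j = 0" if "2*l < k" for j
      using g that by (force simp: hardy_sum_def pw_space_def tensor_space_def)
    show "g l k j = hardy_proj v f l k j"
    proof (cases "k \<le> 2*l")
      case False
      then show ?thesis
        by (simp add: f0 g0 hardy_proj_def row_proj_def)
    next
      case True
      \<comment> \<open>Testing against the k-th monomial tensored with \<open>v l\<close>, placed
        in block \<open>l\<close> alone, isolates row \<open>k\<close> and forces its
        coefficient.\<close>
      let ?\<delta> = "sympoly l (\<lambda>i. if i = k then 1 else 0)"
      define m :: pw where "m = (\<lambda>l'. if l' = l then tensor l ?\<delta> (cscale 1 (v l)) else (\<lambda>_ _. 0))"
      have "m l' = tensor l' (if l' = l then ?\<delta> else 0) (cscale 1 (v l'))" for l'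
        by (auto simp: m_def tensor_def)
      moreover have "(if l' = l then ?\<delta> else 0) \<in> Sym l'" for l'
        by (simp add: sympoly_in_Sym)
      moreover have "summable (\<lambda>l'. Re (tensor_inner l' (m l') (m l')))"
        by (rule summable_finite[of "{l}"]) (auto simp: m_def tensor_inner_def)
      ultimately have "m \<in> hardy_sum v"
        by (intro hardy_sumI[where p = "\<lambda>l'. if l' = l then ?\<delta> else 0"])
      then have "pw_inner (f - g) m = 0"
        using g by blast
      moreover have "pw_inner (f - g) m = tensor_inner l ((f - g) l) (m l)"
        unfolding pw_inner_def by (subst suminf_finite[of "{l}"]) (auto simp: m_def tensor_inner_def)
      moreover have "tensor_inner l ((f - g) l) (m l) = (\<Sum>i\<le>2*l. if i = k then 
          1 / of_nat ((2*l) choose k) * (\<Sum>j\<le>2*l. (f l k j - g l k j) * cnj (mcoeff l (v l) j) / of_nat ((2*l) choose j)) else 0)"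
        unfolding m_def by (simp only: simp_thms if_True tensor_inner_row_sums) (intro sum.cong, auto simp: mcoeff_sympoly)
      ultimately have "(\<Sum>j\<le>2*l. (f l k j - g l k j) * cnj (mcoeff l (v l) j) / of_nat ((2*l) choose j)) = 0"
        using True by (simp add: sum.delta)
      then have eq: "(\<Sum>j\<le>2*l. f l k j * cnj (mcoeff l (v l) j) / of_nat ((2*l) choose j)) =
          (\<Sum>j\<le>2*l. g l k j * cnj (mcoeff l (v l) j) / of_nat ((2*l) choose j))"
        by (simp add: left_diff_distrib diff_divide_distrib sum_subtractf)
      have "\<exists>p\<in>Sym l. \<exists>c. g l = tensor l p (cscale c (v l))"
        using g by (simp add: hardy_sum_def)
      then obtain p c where pc: "g l = tensor l p (cscale c (v l))"
        by blast
      have "(\<Sum>j\<le>2*l. g l k j * cnj (mcoeff l (v l) j) / of_nat ((2*l) choose j)) =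
          mcoeff l p k * c * sym_inner l (v l) (v l)"
        by (simp add: pc tensor_def sym_inner_def sum_distrib_left mult.assoc)
      then have "row_proj v f l k = mcoeff l p k * c"
        using v_pos[of l] unfolding sym_inner_self by (simp add: row_proj_def eq)
      then show ?thesis
        by (simp add: pc tensor_def hardy_proj_def)
    qed
  qed
qed

end

section \<open>Enumeration by square blocks and coordinates on \<open>hardy_Y\<close>\<close>

text \<open>As (l+1)^2 = l^2 + 2l + 1, the blocks of length 2l+1 = dim V_l starting at the squares
  tile the natural numbers, and \<open>floor_sqrt\<close> returns the block number.\<close>

lemma floor_sqrt_square_add: "k \<le> 2*l \<Longrightarrow> floor_sqrt (l\<^sup>2 + k) = l"
  by (rule floor_sqrt_unique) (auto simp: power2_eq_square)

lemma square_add_cases: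
  obtains l k :: nat where "k \<le> 2*l" "n = l\<^sup>2 + k"
proof
  show "n - (floor_sqrt n)\<^sup>2 \<le> 2 * floor_sqrt n"
    using Suc_floor_sqrt_power2_gt[of n] by (simp add: power2_eq_square)
qed simp

lemma bij_betw_square_add: "bij_betw (\<lambda>(l, k). l\<^sup>2 + k) (SIGMA l:UNIV. {..2*l}) (UNIV :: nat set)"
proof (rule bij_betwI')
  fix n :: nat
  obtain l k where "k \<le> 2*l" "n = l\<^sup>2 + k"
    by (rule square_add_cases)
  then show "\<exists>p\<in>SIGMA l:UNIV. {..2*l}. n = (case p of (l, k) \<Rightarrow> l\<^sup>2 + k)"
    by (intro bexI[of _ "(l, k)"]) auto
next
  fix p q :: "nat \<times> nat"
  assume "p \<in> (SIGMA l:UNIV. {..2*l})" "q \<in> (SIGMA l:UNIV. {..2*l})"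
  then obtain l k l' k' where p: "p = (l, k)" "k \<le> 2*l" and q: "q = (l', k')" "k' \<le> 2*l'"
    by auto
  have "l = l'" if "l\<^sup>2 + k = l'\<^sup>2 + k'"
    using floor_sqrt_square_add[OF p(2)] floor_sqrt_square_add[OF q(2)] that by simp
  then show "(case p of (l, k) \<Rightarrow> l\<^sup>2 + k) = (case q of (l, k) \<Rightarrow> l\<^sup>2 + k) \<longleftrightarrow> p = q"
    using p q by auto
qed auto

lemma has_sum_square_blocks:
  fixes h :: "nat \<Rightarrow> 'a::{topological_comm_monoid_add, uniform_space, uniform_topological_group_add, ab_group_add}"
  assumes "(h has_sum s) UNIV"
  shows "((\<lambda>l. \<Sum>k\<le>2*l. h (l\<^sup>2 + k)) has_sum s) UNIV"
proof (rule has_sum_Sigma'[where f = "\<lambda>(l, k). h (l\<^sup>2 + k)" and B = "\<lambda>l. {..2*l}"])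
  have "((\<lambda>p. h (case p of (l, k) \<Rightarrow> l\<^sup>2 + k)) has_sum s) (SIGMA l:UNIV. {..2*l})"
    by (subst has_sum_reindex_bij_betw[OF bij_betw_square_add]) (rule assms)
  then show "((\<lambda>(l, k). h (l\<^sup>2 + k)) has_sum s) (SIGMA l:UNIV. {..2*l})"
    by (simp add: case_prod_unfold)
qed auto

lemma summable_on_square_blocks:
  fixes h :: "nat \<Rightarrow> real"
  assumes "(\<lambda>l. \<Sum>k\<le>2*l. h (l\<^sup>2 + k)) summable_on UNIV" and "\<And>n. h n \<ge> 0"
  shows "h summable_on UNIV"
proof -
  have "(\<lambda>(l, k). h (l\<^sup>2 + k)) summable_on (SIGMA l:UNIV. {..2*l})"
    by (rule summable_on_SigmaI[where g = "\<lambda>l. \<Sum>k\<le>2*l. h (l\<^sup>2 + k)"]) (use assms in auto)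
  then have "(\<lambda>p. h (case p of (l, k) \<Rightarrow> l\<^sup>2 + k)) summable_on (SIGMA l:UNIV. {..2*l})"
    by (simp add: case_prod_unfold)
  then show ?thesis
    by (subst (asm) summable_on_reindex_bij_betw[OF bij_betw_square_add])
qed

text \<open>
  Coordinates on \<^const>\<open>hardy_Y\<close> with respect to the normalised vectors
  \<open>z\<^sub>0\<^sup>2\<^sup>l\<^sup>-\<^sup>k z\<^sub>1\<^sup>k \<otimes> u\<^sub>l\<close>, enumerated by \<open>n = l\<^sup>2 + k\<close> with \<open>k \<le> 2 l\<close>.
\<close>

definition hardy_coord :: "pw \<Rightarrow> nat \<Rightarrow> complex" where
  "hardy_coord f n = (let l = floor_sqrt n; k = n - l\<^sup>2 in f l k 0 / of_real (sqrt (real ((2*l) choose k))))"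

definition of_hardy_coord :: "(nat \<Rightarrow> complex) \<Rightarrow> pw" where
  "of_hardy_coord a = (\<lambda>l k j. if k \<le> 2*l \<and> j = 0
     then a (l\<^sup>2 + k) * of_real (sqrt (real ((2*l) choose k))) else 0)"

lemma hardy_coord_square_add:
  "k \<le> 2*l \<Longrightarrow> hardy_coord f (l\<^sup>2 + k) = f l k 0 / of_real (sqrt (real ((2*l) choose k)))"
  by (simp add: hardy_coord_def floor_sqrt_square_add)

lemma hardy_coord_of_hardy_coord [simp]: "hardy_coord (of_hardy_coord a) = a"
proof
  fix n
  obtain l k :: nat where "k \<le> 2*l" "n = l\<^sup>2 + k"
    by (rule square_add_cases)
  then show "hardy_coord (of_hardy_coord a) n = a n"
    by (simp add: hardy_coord_square_add of_hardy_coord_def)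
qed

lemma Z0_power: "Z0 ^ n = [:monom 1 n:]"
  by (induction n) (simp_all add: Z0_def one_pCons monom_Suc monom_0)

lemma mcoeff_u_vec: "mcoeff l (u_vec l) k = (if k = 0 then 1 else 0)"
  by (simp add: mcoeff_def u_vec_def Z0_power coeff_pCons split: nat.splits)

lemma u_vec_in_Sym: "u_vec l \<in> Sym l"
  by (auto simp: Sym_def u_vec_def Z0_power coeff_pCons split: nat.splits if_splits)

lemma sym_sqnorm_u_vec [simp]: "sym_sqnorm l (u_vec l) = 1"
  by (simp add: sym_sqnorm_def mcoeff_u_vec if_distrib[of "\<lambda>x. x / _"] if_distrib[of cmod] if_distrib[of "\<lambda>x. x ^ _"] sum.delta cong: if_cong)


text \<open>Since \<open>u_vec l\<close> is a single monomial of weight 1, only the column j = 0 is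
  occupied, and the square roots in \<open>hardy_coord\<close> absorb the remaining weights. This
  identifies \<open>hardy_Y\<close> with the square-summable sequences.\<close>

lemma hardy_Y_iff:
  "f \<in> hardy_Y \<longleftrightarrow> (\<forall>l k j. f l k j \<noteq> 0 \<longrightarrow> k \<le> 2*l \<and> j = 0) \<and> l2 (hardy_coord f)"
proof -
  have supp: "(\<forall>l. \<exists>p\<in>Sym l. \<exists>c. f l = tensor l p (cscale c (u_vec l))) \<longleftrightarrow>
      (\<forall>l k j. f l k j \<noteq> 0 \<longrightarrow> k \<le> 2*l \<and> j = 0)"
  proof safe
    fix l k j assume "\<forall>l. \<exists>p\<in>Sym l. \<exists>c. f l = tensor l p (cscale c (u_vec l))" "f l k j \<noteq> 0"
    then obtain p c where "p \<in> Sym l" "tensor l p (cscale c (u_vec l)) k j \<noteq> 0"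
      by metis
    then show "k \<le> 2*l" "j = 0"
      using mcoeff_eq_0[of p l k] by (auto simp: tensor_def mcoeff_u_vec not_less[symmetric] split: if_splits)
  next
    fix l assume *: "\<forall>l k j. f l k j \<noteq> 0 \<longrightarrow> k \<le> 2*l \<and> j = 0"
    have "f l k j = tensor l (sympoly l (\<lambda>k. f l k 0)) (cscale 1 (u_vec l)) k j" for k j
      using * mcoeff_eq_0[OF sympoly_in_Sym, of l k]
      by (cases "k \<le> 2*l") (force simp: tensor_def mcoeff_u_vec mcoeff_sympoly)+
    then show "\<exists>p\<in>Sym l. \<exists>c. f l = tensor l p (cscale c (u_vec l))"
      using sympoly_in_Sym by blast
  qed
  have "summable (\<lambda>l. Re (tensor_inner l (f l) (f l))) \<longleftrightarrow> l2 (hardy_coord f)"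
    if *: "\<forall>l k j. f l k j \<noteq> 0 \<longrightarrow> k \<le> 2*l \<and> j = 0"
  proof -
    have row: "(\<Sum>j\<le>2*l. (cmod (f l k j))\<^sup>2 / real ((2*l) choose j)) = (cmod (f l k 0))\<^sup>2" for l k
    proof -
      have "(\<Sum>j\<le>2*l. (cmod (f l k j))\<^sup>2 / real ((2*l) choose j)) = (\<Sum>j\<in>{0}. (cmod (f l k j))\<^sup>2 / real ((2*l) choose j))"
        using * by (intro sum.mono_neutral_right) auto
      then show ?thesis
        by simp
    qed
    have eq: "Re (tensor_inner l (f l) (f l)) = (\<Sum>k\<le>2*l. (cmod (hardy_coord f (l\<^sup>2 + k)))\<^sup>2)" for l
      unfolding Re_tensor_inner_self row
      by (intro sum.cong) (auto simp: hardy_coord_square_add norm_divide power_divide)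
    have "summable (\<lambda>l. Re (tensor_inner l (f l) (f l))) \<longleftrightarrow>
        (\<lambda>l. \<Sum>k\<le>2*l. (cmod (hardy_coord f (l\<^sup>2 + k)))\<^sup>2) summable_on UNIV"
      unfolding eq by (intro summable_on_UNIV_nonneg_real_iff[symmetric] sum_nonneg) auto
    also have "\<dots> \<longleftrightarrow> l2 (hardy_coord f)"
      unfolding l2_def using summable_on_square_blocks[of "\<lambda>n. (cmod (hardy_coord f n))\<^sup>2"]
        has_sum_square_blocks[of "\<lambda>n. (cmod (hardy_coord f n))\<^sup>2"]
      by (auto simp: summable_on_def)
    finally show ?thesis .
  qed
  then show ?thesis
    unfolding hardy_Y_def hardy_sum_def pw_space_def mem_Collect_eq supp
    by (auto simp: tensor_space_def)
qed

lemma hardy_Y_eq_0: "f \<in> hardy_Y \<Longrightarrow> \<not> (k \<le> 2*l \<and> j = 0) \<Longrightarrow> f l k j = 0"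
  unfolding hardy_Y_iff by blast

lemma of_hardy_coord_in_hardy_Y: "l2 a \<Longrightarrow> of_hardy_coord a \<in> hardy_Y"
  unfolding hardy_Y_iff hardy_coord_of_hardy_coord by (simp add: of_hardy_coord_def)

lemma pw_inner_hardy_Y:
  assumes f: "f \<in> hardy_Y" and g: "g \<in> hardy_Y"
  shows "pw_inner f g = l2_inner (hardy_coord f) (hardy_coord g)"
proof -
  have eq: "tensor_inner l (f l) (g l) = (\<Sum>k\<le>2*l. hardy_coord f (l\<^sup>2 + k) * cnj (hardy_coord g (l\<^sup>2 + k)))" for l
    unfolding tensor_inner_def
  proof (rule sum.cong[OF refl])
    fix k assume k: "k \<in> {..2*l}"
    have "(\<Sum>j\<le>2*l. f l k j * cnj (g l k j) / (of_nat ((2*l) choose k) * of_nat ((2*l) choose j))) =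
        (\<Sum>j\<in>{0}. f l k j * cnj (g l k j) / (of_nat ((2*l) choose k) * of_nat ((2*l) choose j)))"
      using hardy_Y_eq_0[OF f] by (intro sum.mono_neutral_right) auto
    also have "\<dots> = f l k 0 * cnj (g l k 0) / of_real ((sqrt (real ((2*l) choose k)))\<^sup>2)"
      by (simp del: of_real_power)
    also have "\<dots> = hardy_coord f (l\<^sup>2 + k) * cnj (hardy_coord g (l\<^sup>2 + k))"
      using k unfolding power2_eq_square[of "sqrt _"] by (simp add: hardy_coord_square_add del: real_sqrt_mult_self)
    finally show "(\<Sum>j\<le>2*l. f l k j * cnj (g l k j) / (of_nat ((2*l) choose k) * of_nat ((2*l) choose j))) =
        hardy_coord f (l\<^sup>2 + k) * cnj (hardy_coord g (l\<^sup>2 + k))" .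
  qed
  have "((\<lambda>l. tensor_inner l (f l) (g l)) has_sum l2_inner (hardy_coord f) (hardy_coord g)) UNIV"
    unfolding eq using f g by (intro has_sum_square_blocks l2_inner_has_sum) (auto simp: hardy_Y_iff)
  then show ?thesis
    unfolding pw_inner_def using has_sum_imp_sums sums_unique by metis
qed


section \<open>Traces of the exterior powers of the Toeplitz operator\<close>

lemma Sym_mult:
  assumes "p \<in> Sym a" "q \<in> Sym b"
  shows "p * q \<in> Sym (a + b)"
  unfolding Sym_def
proof safe
  fix i j assume "coeff (coeff (p * q) j) i \<noteq> 0"
  then have "(\<Sum>m\<le>j. \<Sum>n\<le>i. coeff (coeff p m) n * coeff (coeff q (j - m)) (i - n)) \<noteq> 0"
    by (simp add: coeff_mult coeff_sum)
  then obtain m n where "m \<le> j" "n \<le> i" "coeff (coeff p m) n \<noteq> 0" "coeff (coeff q (j - m)) (i - n) \<noteq> 0"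
    by (metis (no_types, lifting) atMost_iff mult_zero_left mult_zero_right sum.not_neutral_contains_not_neutral)
  then have "n + m = 2 * a" "(i - n) + (j - m) = 2 * b"
    using assms by (auto simp: Sym_def)
  then show "i + j = 2 * (a + b)"
    using \<open>m \<le> j\<close> \<open>n \<le> i\<close> by simp
qed

lemma Sym_power:
  assumes "p \<in> Sym 1"
  shows "p ^ l \<in> Sym l"
proof (induction l)
  case 0
  then show ?case
    by (auto simp: Sym_def)
next
  case (Suc l)
  then show ?case
    using Sym_mult[OF assms Suc] by simp
qed

lemma w_vec_eq: "w_vec \<tau> l = [:monom 1 2, monom (of_real (2 * (cosh \<tau> / sinh \<tau>))) 1, 1:] ^ l"
proof -
  have "(Z0\<^sup>2 + Z1\<^sup>2 + cscale c (Z0 * Z1)) = [:monom 1 2, monom c 1, 1:]" for c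
    by (simp add: Z0_def Z1_def cscale_def power2_eq_square monom_altdef numeral_2_eq_2)
  then show ?thesis
    by (simp add: w_vec_def)
qed

lemma w_vec_in_Sym: "w_vec \<tau> l \<in> Sym l"
  unfolding w_vec_eq
  by (rule Sym_power) (auto simp: Sym_def coeff_pCons split: nat.splits if_splits)

lemma mcoeff_w_vec_0: "mcoeff l (w_vec \<tau> l) 0 = 1"
  by (simp add: mcoeff_def w_vec_eq coeff_0_power monom_power)

lemma poly_sympoly_1: "poly (poly (sympoly l c) 1) 1 = (\<Sum>k\<le>2*l. c k)"
  by (simp add: sympoly_def poly_sum poly_monom)

lemma sum_mcoeff_w_vec: "(\<Sum>k\<le>2*l. mcoeff l (w_vec \<tau> l) k) = of_real (2 + 2 * (cosh \<tau> / sinh \<tau>)) ^ l"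
proof -
  have "poly (poly (w_vec \<tau> l) 1) 1 = (\<Sum>k\<le>2*l. mcoeff l (w_vec \<tau> l) k)"
    using poly_sympoly_1[of l "mcoeff l (w_vec \<tau> l)"] by (simp only: sympoly_mcoeff[OF w_vec_in_Sym])
  moreover have "poly (poly (w_vec \<tau> l) 1) 1 = of_real (2 + 2 * (cosh \<tau> / sinh \<tau>)) ^ l"
    by (simp add: w_vec_eq poly_monom)
  ultimately show ?thesis
    by simp
qed

text \<open>
  Cauchy--Schwarz for the coefficient sum, i.e. evaluation at \<open>z\<^sub>0 = z\<^sub>1 = 1\<close>:
  \<open>(2 + 2 coth \<tau>)\<^sup>2\<^sup>l \<le> \<parallel>w\<^sub>l\<parallel>\<^sup>2 2\<^sup>2\<^sup>l\<close>, and \<open>coth \<tau> > 1\<close>.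
\<close>

lemma sym_sqnorm_w_vec_ge:
  assumes "\<tau> > 0"
  shows "4 ^ l \<le> sym_sqnorm l (w_vec \<tau> l)"
proof -
  have sinh: "sinh \<tau> > 0"
    using assms by simp
  have "(16::real) ^ l \<le> ((2 + 2 * (cosh \<tau> / sinh \<tau>)) ^ l)\<^sup>2"
  proof -
    have "1 \<le> cosh \<tau> / sinh \<tau>"
      using sinh sinh_less_cosh_real[of \<tau>] by simp
    then have "4 \<le> 2 + 2 * (cosh \<tau> / sinh \<tau>)"
      by linarith
    then have "4 ^ l \<le> (2 + 2 * (cosh \<tau> / sinh \<tau>)) ^ l"
      by (intro power_mono) auto
    then have "(4 ^ l)\<^sup>2 \<le> ((2 + 2 * (cosh \<tau> / sinh \<tau>)) ^ l)\<^sup>2"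
      by (rule power_mono) simp
    moreover have "(16::real) ^ l = (4 ^ l)\<^sup>2"
      by (simp add: power2_eq_square flip: power_mult_distrib)
    ultimately show ?thesis
      by (simp only:)
  qed
  also have "\<dots> = (cmod (\<Sum>k\<le>2*l. mcoeff l (w_vec \<tau> l) k))\<^sup>2"
    unfolding sum_mcoeff_w_vec norm_power norm_of_real power_abs[symmetric] by (rule abs_of_nonneg[symmetric]) simp
  \<comment> \<open>Writing 1 as a quotient of binomials turns the evaluation into the inner product
    with the power 2l of z0 + z1, whose squared norm is 4^l.\<close>
  also have "\<dots> = (cmod (\<Sum>k\<le>2*l. mcoeff l (w_vec \<tau> l) k * cnj (of_nat ((2*l) choose k)) / of_nat ((2*l) choose k)))\<^sup>2"
    by (intro arg_cong[where f = "\<lambda>x. (cmod x)\<^sup>2"] sum.cong) auto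
  also have "\<dots> \<le> sym_sqnorm l (w_vec \<tau> l) *
      (\<Sum>k\<le>2*l. (cmod (of_nat ((2*l) choose k)))\<^sup>2 / real ((2*l) choose k))"
    unfolding sym_sqnorm_def by (rule weighted_cauchy_schwarz)
  also have "(\<Sum>k\<le>2*l. (cmod (of_nat ((2*l) choose k)))\<^sup>2 / real ((2*l) choose k)) = real (\<Sum>k\<le>2*l. (2*l) choose k)"
    unfolding of_nat_sum by (intro sum.cong) (auto simp: power2_eq_square)
  also have "\<dots> = 4 ^ l"
    unfolding choose_row_sum by (simp add: power_mult)
  finally have "4 ^ l * 4 ^ l \<le> sym_sqnorm l (w_vec \<tau> l) * 4 ^ l"
    by (simp flip: power_mult_distrib)
  then show ?thesis
    by simp
qed

lemma sym_sqnorm_w_vec_pos: "\<tau> > 0 \<Longrightarrow> sym_sqnorm l (w_vec \<tau> l) > 0"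
  using sym_sqnorm_w_vec_ge[of \<tau> l] zero_less_power[of "4::real" l] by linarith

text \<open>The leading coefficient of \<open>w_vec \<tau> l\<close> is 1 and \<open>u_vec l\<close>
  is a unit vector, so only the normalisation of \<open>w_vec \<tau> l\<close> is left.\<close>

lemma s_coef_eq:
  assumes "\<tau> > 0"
  shows "s_coef l \<tau> = 1 / sym_sqnorm l (w_vec \<tau> l)"
proof -
  have inner: "sym_inner l p (u_vec l) = mcoeff l p 0" for p
  proof -
    have "sym_inner l p (u_vec l) = (\<Sum>k\<in>{0}. mcoeff l p k * cnj (mcoeff l (u_vec l) k) / of_nat ((2*l) choose k))"
      unfolding sym_inner_def by (rule sum.mono_neutral_right) (auto simp: mcoeff_u_vec)
    then show ?thesis
      by (simp add: mcoeff_u_vec)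
  qed
  have "sym_hat l (u_vec l) = u_vec l"
    by (simp add: sym_hat_def sym_norm_def sym_inner_self cscale_def pCons_one)
  then show ?thesis
    using sym_sqnorm_w_vec_pos[OF assms, of l]
    by (simp add: s_coef_def inner sym_hat_def sym_norm_def sym_inner_self mcoeff_w_vec_0
        norm_divide power_divide)
qed

lemma s_coef_pos: "\<tau> > 0 \<Longrightarrow> s_coef l \<tau> > 0"
  by (simp add: s_coef_eq sym_sqnorm_w_vec_pos)

lemma s_coef_le: "\<tau> > 0 \<Longrightarrow> s_coef l \<tau> \<le> (1 / 4) ^ l"
  using sym_sqnorm_w_vec_ge[of \<tau> l] sym_sqnorm_w_vec_pos[of \<tau> l]
  by (simp add: s_coef_eq power_divide frac_le)

text \<open>Going from u to w and back, both pairings equal the leading coefficient 1 of w. The only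
  factor is the division by the squared norm of w in the middle projection.\<close>

lemma T_op_eq:
  assumes \<tau>: "\<tau> > 0" and f: "f \<in> hardy_Y"
  shows "T_op \<tau> f = (\<lambda>l k j. of_real (s_coef l \<tau>) * f l k j)"
proof -
  have f_pw: "f \<in> pw_space"
    using f by (simp add: hardy_Y_def hardy_sum_def)
  have row_u: "row_proj u_vec g l k = g l k 0" for g l k
  proof -
    have "(\<Sum>j\<le>2*l. g l k j * cnj (mcoeff l (u_vec l) j) / of_nat ((2*l) choose j)) =
        (\<Sum>j\<in>{0}. g l k j * cnj (mcoeff l (u_vec l) j) / of_nat ((2*l) choose j))"
      by (rule sum.mono_neutral_right) (auto simp: mcoeff_u_vec)
    then show ?thesis
      by (simp add: row_proj_def mcoeff_u_vec)
  qed
  have row_w: "row_proj (w_vec \<tau>) f l k = of_real (s_coef l \<tau>) * f l k 0" for l k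
  proof -
    have "(\<Sum>j\<le>2*l. f l k j * cnj (mcoeff l (w_vec \<tau> l) j) / of_nat ((2*l) choose j)) =
        (\<Sum>j\<in>{0}. f l k j * cnj (mcoeff l (w_vec \<tau> l) j) / of_nat ((2*l) choose j))"
      using hardy_Y_eq_0[OF f] by (intro sum.mono_neutral_right) auto
    then show ?thesis
      by (simp add: row_proj_def mcoeff_w_vec_0 s_coef_eq[OF \<tau>])
  qed
  have Y: "orth_proj hardy_Y g = hardy_proj u_vec g" if "g \<in> pw_space" for g
    unfolding hardy_Y_def using that by (intro orth_proj_hardy_sum u_vec_in_Sym) auto
  have "hardy_proj u_vec f = f"
    using hardy_Y_eq_0[OF f] by (intro ext) (simp add: hardy_proj_def row_u mcoeff_u_vec)
  then have Yf: "orth_proj hardy_Y f = f"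
    using Y[OF f_pw] by simp
  have tube: "orth_proj (hardy_tube \<tau>) f = hardy_proj (w_vec \<tau>) f"
    unfolding hardy_tube_def
    by (rule orth_proj_hardy_sum[OF w_vec_in_Sym sym_sqnorm_w_vec_pos[OF \<tau>] f_pw])
  have "hardy_proj (w_vec \<tau>) f \<in> hardy_sum (w_vec \<tau>)"
    by (rule hardy_proj_in_hardy_sum[OF w_vec_in_Sym sym_sqnorm_w_vec_pos[OF \<tau>] f_pw])
  then have "hardy_proj (w_vec \<tau>) f \<in> pw_space"
    by (simp add: hardy_sum_def)
  then have "T_op \<tau> f = hardy_proj u_vec (hardy_proj (w_vec \<tau>) f)"
    by (simp add: T_op_def Yf tube Y)
  also have "\<dots> = (\<lambda>l k j. of_real (s_coef l \<tau>) * f l k j)"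
    using hardy_Y_eq_0[OF f]
    by (intro ext) (simp add: hardy_proj_def row_u row_w mcoeff_u_vec mcoeff_w_vec_0)
  finally show ?thesis .
qed

section \<open>Hilbert bases of \<open>hardy_Y\<close> and the value of the traces\<close>

lemma hardy_coord_diff_sum:
  "hardy_coord (\<lambda>l k j. x l k j - (\<Sum>e\<in>S. c e * e l k j)) =
    (\<lambda>n. hardy_coord x n - (\<Sum>e\<in>S. c e * hardy_coord e n))"
  by (intro ext) (simp add: hardy_coord_def Let_def diff_divide_distrib sum_divide_distrib)

lemma hilbert_basis_columns_orthonormal:
  assumes "hilbert_basis hardy_Y E"
  shows "((\<lambda>e. hardy_coord e i * cnj (hardy_coord e j)) has_sum (if i = j then 1 else 0)) E"
proof (rule l2_basis_columns_orthonormal)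
  have E: "E \<subseteq> hardy_Y" and ortho: "\<And>e f. e \<in> E \<Longrightarrow> f \<in> E \<Longrightarrow> pw_inner e f = (if e = f then 1 else 0)"
    and dense: "\<And>x \<epsilon>. x \<in> hardy_Y \<Longrightarrow> \<epsilon> > 0 \<Longrightarrow> \<exists>S c. finite S \<and> S \<subseteq> E \<and>
        pw_norm (\<lambda>l k j. x l k j - (\<Sum>e\<in>S. c e * e l k j)) < \<epsilon>"
    using assms unfolding hilbert_basis_def by blast+
  show l2: "l2 (hardy_coord e)" if "e \<in> E" for e
    using that E by (auto simp: hardy_Y_iff)
  show l2_ortho: "l2_inner (hardy_coord e) (hardy_coord f) = (if e = f then 1 else 0)"
    if "e \<in> E" "f \<in> E" for e f
  proof -
    have "e \<in> hardy_Y" "f \<in> hardy_Y"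
      using that E by blast+
    then show ?thesis
      using ortho[OF that] pw_inner_hardy_Y by metis
  qed
  fix a :: "nat \<Rightarrow> complex" and \<epsilon> :: real
  assume a: "l2 a" and \<epsilon>: "\<epsilon> > 0"
  \<comment> \<open>Density of a Hilbert basis is stated for the norm, Parseval for its square;
    hence the square root.\<close>
  obtain S c where S: "finite S" "S \<subseteq> E"
    and less: "pw_norm (\<lambda>l k j. of_hardy_coord a l k j - (\<Sum>e\<in>S. c e * e l k j)) < sqrt \<epsilon>"
    using dense[OF of_hardy_coord_in_hardy_Y[OF a], of "sqrt \<epsilon>"] \<epsilon> by auto
  let ?d = "\<lambda>l k j. of_hardy_coord a l k j - (\<Sum>e\<in>S. c e * e l k j)"
  have co: "hardy_coord ?d = (\<lambda>n. a n - (\<Sum>e\<in>S. c e * hardy_coord e n))"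
    by (simp add: hardy_coord_diff_sum)
  have "l2 (hardy_coord ?d)"
    unfolding co by (rule l2_sqnorm_diff_orthonormal(1)[OF l2 a l2_ortho S])
  \<comment> \<open>The error has to lie in \<open>hardy_Y\<close> before its norm can be read off
    in coordinates.\<close>
  moreover have "?d l k j = 0" if "\<not> (k \<le> 2*l \<and> j = 0)" for l k j
  proof -
    have "e l k j = 0" if "e \<in> S" for e
      using that S E hardy_Y_eq_0[of e k l j] \<open>\<not> (k \<le> 2*l \<and> j = 0)\<close> by blast
    then have "(\<Sum>e\<in>S. c e * e l k j) = 0"
      by (intro sum.neutral) simp
    moreover have "of_hardy_coord a l k j = 0"
      using that by (auto simp: of_hardy_coord_def)
    ultimately show ?thesis
      by simp
  qed
  ultimately have "?d \<in> hardy_Y"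
    unfolding hardy_Y_iff by blast
  then have "pw_inner ?d ?d = l2_inner (hardy_coord ?d) (hardy_coord ?d)"
    by (intro pw_inner_hardy_Y)
  also have "\<dots> = of_real (l2_sqnorm (hardy_coord ?d))"
    by (rule l2_inner_self) fact
  finally have "pw_norm ?d = sqrt (l2_sqnorm (\<lambda>n. a n - (\<Sum>e\<in>S. c e * hardy_coord e n)))"
    unfolding pw_norm_def co by simp
  then show "\<exists>S c. finite S \<and> S \<subseteq> E \<and> l2_sqnorm (\<lambda>i. a i - (\<Sum>e\<in>S. c e * hardy_coord e i)) < \<epsilon>"
    using S less by (intro exI[of _ S] exI[of _ c]) simp
qed

text \<open>Without a basis the condition in \<open>trace_ext_power\<close> would be vacuous and
  would single out no value. The witness is the preimage of the unit sequences.\<close>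

lemma hilbert_basis_hardy_Y_exists: "\<exists>E. hilbert_basis hardy_Y E"
proof
  define \<delta> :: "nat \<Rightarrow> nat \<Rightarrow> complex" where "\<delta> m = (\<lambda>n. if n = m then 1 else 0)" for m
  define b where "b m = of_hardy_coord (\<delta> m)" for m
  have \<delta>_l2: "l2 (\<delta> m)" for m
    by (rule l2_finite_support) (simp add: \<delta>_def)
  have \<delta>_inner: "l2_inner a (\<delta> m) = a m" for a m
    unfolding l2_inner_def
    by (rule infsumI, rule has_sum_finite_neutralI[of "{m}"]) (auto simp: \<delta>_def)
  have b_Y: "b m \<in> hardy_Y" for m
    unfolding b_def by (rule of_hardy_coord_in_hardy_Y[OF \<delta>_l2])
  have co: "hardy_coord (b m) = \<delta> m" for m
    by (simp add: b_def)
  have "inj b"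
    by (rule injI) (metis \<delta>_def co zero_neq_one)
  have inner: "pw_inner (b m) (b n) = \<delta> m n" for m n
    by (simp add: pw_inner_hardy_Y[OF b_Y b_Y] co \<delta>_inner)
  show "hilbert_basis hardy_Y (range b)"
    unfolding hilbert_basis_def
  proof (intro conjI ballI allI impI)
    show "range b \<subseteq> hardy_Y"
      using b_Y by auto
    fix e f assume "e \<in> range b" "f \<in> range b"
    then show "pw_inner e f = (if e = f then 1 else 0)"
      using inner inj_eq[OF \<open>inj b\<close>] by (auto simp: \<delta>_def)
  next
    fix x \<epsilon> assume x: "x \<in> hardy_Y" and \<epsilon>: "(\<epsilon>::real) > 0"
    define a where "a = hardy_coord x"
    have a: "l2 a"
      using x by (simp add: a_def hardy_Y_iff)
    have "eventually (\<lambda>F. dist (\<Sum>n\<in>F. (cmod (a n))\<^sup>2) (l2_sqnorm a) < \<epsilon>\<^sup>2) (finite_subsets_at_top UNIV)"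
      using l2_has_sum[OF a] \<epsilon> unfolding has_sum_def tendsto_iff by simp
    then obtain F :: "nat set" where F: "finite F" "dist (\<Sum>n\<in>F. (cmod (a n))\<^sup>2) (l2_sqnorm a) < \<epsilon>\<^sup>2"
      unfolding eventually_finite_subsets_at_top by blast
    \<comment> \<open>Coefficients are indexed by the vectors themselves, so injectivity of
      \<open>b\<close> is needed to return to indices.\<close>
    define c where "c e = pw_inner x e" for e
    have c: "c (b m) = a m" for m
      by (simp add: c_def pw_inner_hardy_Y[OF x b_Y] co \<delta>_inner a_def)
    let ?d = "\<lambda>l k j. x l k j - (\<Sum>e\<in>b ` F. c e * e l k j)"
    have co_d: "hardy_coord ?d = (\<lambda>n. a n - (\<Sum>m\<in>F. a m * \<delta> m n))"
      unfolding hardy_coord_diff_sum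
      by (subst sum.reindex) (use inj_on_subset[OF \<open>inj b\<close>] in \<open>auto simp: c co a_def\<close>)
    have ortho: "l2_inner (\<delta> m) (\<delta> n) = (if m = n then 1 else 0)" for m n
      by (simp add: \<delta>_inner) (simp add: \<delta>_def)
    have l2_d: "l2 (hardy_coord ?d)"
      unfolding co_d by (rule l2_sqnorm_diff_orthonormal(1)[OF \<delta>_l2 a ortho F(1)]) auto
    have "l2_sqnorm (hardy_coord ?d) = l2_sqnorm a - (\<Sum>n\<in>F. (cmod (a n))\<^sup>2)"
      unfolding co_d
      by (subst l2_sqnorm_diff_orthonormal(3)[where E = UNIV and U = \<delta>, OF \<delta>_l2 a ortho F(1)])
         (auto simp: \<delta>_inner sum_negf)
    then have less: "l2_sqnorm (hardy_coord ?d) < \<epsilon>\<^sup>2"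
      using F(2) by (simp add: dist_real_def abs_less_iff)
    have "?d l k j = 0" if "\<not> (k \<le> 2*l \<and> j = 0)" for l k j
    proof -
      have "e l k j = 0" if "e \<in> b ` F" for e
        using that b_Y hardy_Y_eq_0[of e k l j] \<open>\<not> (k \<le> 2*l \<and> j = 0)\<close> by blast
      then have "(\<Sum>e\<in>b ` F. c e * e l k j) = 0"
        by (intro sum.neutral) simp
      moreover have "x l k j = 0"
        using hardy_Y_eq_0[OF x that] .
      ultimately show ?thesis
        by simp
    qed
    then have "?d \<in> hardy_Y"
      using l2_d unfolding hardy_Y_iff by blast
    then have "pw_norm ?d = sqrt (l2_sqnorm (hardy_coord ?d))"
      unfolding pw_norm_def by (simp add: pw_inner_hardy_Y l2_inner_self[OF l2_d])
    also have "\<dots> < \<epsilon>"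
      using real_sqrt_less_mono[OF less] \<epsilon> by simp
    finally show "\<exists>S c. finite S \<and> S \<subseteq> range b \<and>
        pw_norm (\<lambda>l k j. x l k j - (\<Sum>e\<in>S. c e * e l k j)) < \<epsilon>"
      using F(1) by (intro exI[of _ "b ` F"] exI[of _ c]) auto
  qed
qed

lemma trace_ext_power_eq:
  fixes z :: complex
  assumes \<tau>: "\<tau> > 0" and summable: "(\<lambda>n. s_coef (floor_sqrt n) \<tau>) summable_on UNIV"
  shows "trace_ext_power hardy_Y (\<lambda>f. pw_scale (- z) (T_op \<tau> f)) n =
    (\<Sum>\<^sub>\<infinity>J\<in>{J. J \<subseteq> UNIV \<and> finite J \<and> card J = n}. \<Prod>i\<in>J. - z * of_real (s_coef (floor_sqrt i) \<tau>))"
    (is "trace_ext_power hardy_Y ?A n = ?t")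
proof -
  define \<mu> where "\<mu> i = - z * of_real (s_coef (floor_sqrt i) \<tau>)" for i
  have \<mu>_le: "cmod (\<mu> i) \<le> cmod z" for i
  proof -
    have "s_coef (floor_sqrt i) \<tau> \<le> 1"
      using s_coef_le[OF \<tau>, of "floor_sqrt i"] power_le_one[of "1/4::real" "floor_sqrt i"] by simp
    then show ?thesis
      using s_coef_pos[OF \<tau>, of "floor_sqrt i"] by (simp add: \<mu>_def norm_mult mult_left_le)
  qed
  have \<mu>: "\<mu> abs_summable_on UNIV"
    unfolding \<mu>_def norm_mult norm_minus_cancel norm_of_real
    using summable s_coef_pos[OF \<tau>] by (intro summable_on_cmult_right) (simp add: abs_of_pos)
  have sum: "((\<lambda>S. det_on S (\<lambda>e f. pw_inner (?A f) e)) has_sum ?t) {S. S \<subseteq> E \<and> finite S \<and> card S = n}"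
    if E: "hilbert_basis hardy_Y E" for E
    unfolding \<mu>_def[symmetric]
  proof (rule has_sum_principal_minors[OF \<mu>])
    show "((\<lambda>e. hardy_coord e i * cnj (hardy_coord e j)) has_sum (if i = j then 1 else 0)) E" for i j
      by (rule hilbert_basis_columns_orthonormal[OF E])
    fix e f assume "e \<in> E" "f \<in> E"
    then have e: "e \<in> hardy_Y" and f: "f \<in> hardy_Y"
      using E by (auto simp: hilbert_basis_def)
    have Af: "?A f = (\<lambda>l k j. - z * (of_real (s_coef l \<tau>) * f l k j))"
      by (simp add: pw_scale_def T_op_eq[OF \<tau> f])
    have co: "hardy_coord (?A f) = (\<lambda>i. \<mu> i * hardy_coord f i)"
      unfolding Af by (intro ext) (simp add: hardy_coord_def \<mu>_def Let_def)
    have l2f: "l2 (hardy_coord f)" and l2e: "l2 (hardy_coord e)"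
      using e f by (auto simp: hardy_Y_iff)
    \<comment> \<open>The multipliers are bounded by \<open>cmod z\<close>, so the image of
      \<open>f\<close> stays in \<open>hardy_Y\<close> and its inner products can be computed in
      coordinates.\<close>
    have "(\<lambda>i. (cmod (\<mu> i * hardy_coord f i))\<^sup>2) abs_summable_on UNIV"
    proof (rule Infinite_Sum.abs_summable_on_comparison_test')
      show "(\<lambda>i. (cmod z)\<^sup>2 * (cmod (hardy_coord f i))\<^sup>2) summable_on UNIV"
        using l2f by (intro summable_on_cmult_right) (simp add: l2_def)
      show "norm ((cmod (\<mu> i * hardy_coord f i))\<^sup>2) \<le> (cmod z)\<^sup>2 * (cmod (hardy_coord f i))\<^sup>2" for i
        using \<mu>_le[of i] by (simp add: norm_mult power_mult_distrib mult_right_mono power_mono)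
    qed
    then have l2A: "l2 (\<lambda>i. \<mu> i * hardy_coord f i)"
      by (simp add: l2_def)
    have "?A f l k j = 0" if "\<not> (k \<le> 2*l \<and> j = 0)" for l k j
      unfolding Af using hardy_Y_eq_0[OF f that] by simp
    then have "?A f \<in> hardy_Y"
      unfolding hardy_Y_iff co using l2A by blast
    then have "pw_inner (?A f) e = l2_inner (\<lambda>i. \<mu> i * hardy_coord f i) (hardy_coord e)"
      using pw_inner_hardy_Y[OF _ e] co by simp
    then show "((\<lambda>i. \<mu> i * hardy_coord f i * cnj (hardy_coord e i)) has_sum pw_inner (?A f) e) UNIV"
      using l2_inner_has_sum[OF l2A l2e] by simp
  qed
  show ?thesis
    unfolding trace_ext_power_def
  proof (rule the_equality)
    show "\<forall>E. hilbert_basis hardy_Y E \<longrightarrow> ((\<lambda>S. det_on S (\<lambda>e f. pw_inner (?A f) e)) has_sum ?t) {S. S \<subseteq> E \<and> finite S \<and> card S = n}"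
      using sum by blast
    fix t assume t: "\<forall>E. hilbert_basis hardy_Y E \<longrightarrow> ((\<lambda>S. det_on S (\<lambda>e f. pw_inner (?A f) e)) has_sum t) {S. S \<subseteq> E \<and> finite S \<and> card S = n}"
    obtain E where "hilbert_basis hardy_Y E"
      using hilbert_basis_hardy_Y_exists by blast
    then show "t = ?t"
      using t sum has_sum_unique by blast
  qed
qed


section \<open>The determinant as an infinite product\<close>

lemma prod_one_plus_eq_sum_Pow:
  fixes f :: "'a \<Rightarrow> 'b::comm_ring_1"
  assumes "finite A"
  shows "(\<Prod>x\<in>A. 1 + f x) = (\<Sum>X\<in>Pow A. \<Prod>x\<in>X. f x)"
  using prod_add[OF assms, of f "\<lambda>_. 1"] by (simp add: add.commute)

text \<open>Any finite collection of finite sets lies in the power set of its union, where the sum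
  factors into a product bounded by the exponential of the total of the moduli.\<close>

lemma abs_summable_on_finite_subset_products:
  fixes \<mu> :: "'i \<Rightarrow> complex"
  assumes "\<mu> abs_summable_on UNIV"
  shows "(\<lambda>J. \<Prod>i\<in>J. \<mu> i) abs_summable_on {J. finite J}"
proof (rule nonneg_bdd_above_summable_on)
  show "bdd_above (sum (\<lambda>J. norm (\<Prod>i\<in>J. \<mu> i)) ` {F. F \<subseteq> {J. finite J} \<and> finite F})"
  proof (rule bdd_aboveI2)
    fix F :: "'i set set" assume "F \<in> {F. F \<subseteq> {J. finite J} \<and> finite F}"
    then have fin: "finite (\<Union>F)" and "finite F"
      by auto
    have "(\<Sum>J\<in>F. norm (\<Prod>i\<in>J. \<mu> i)) \<le> (\<Sum>J\<in>Pow (\<Union>F). norm (\<Prod>i\<in>J. \<mu> i))"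
      using fin by (intro sum_mono2) auto
    also have "\<dots> = (\<Prod>i\<in>\<Union>F. 1 + norm (\<mu> i))"
      using prod_one_plus_eq_sum_Pow[OF fin, of "\<lambda>i. norm (\<mu> i)"] by (simp add: prod_norm)
    also have "\<dots> \<le> exp (\<Sum>i\<in>\<Union>F. norm (\<mu> i))"
      by (rule prod_le_exp_sum) simp
    also have "\<dots> \<le> exp (infsum (\<lambda>i. norm (\<mu> i)) UNIV)"
      using assms fin by (simp add: finite_sum_le_infsum)
    finally show "(\<Sum>J\<in>F. norm (\<Prod>i\<in>J. \<mu> i)) \<le> exp (infsum (\<lambda>i. norm (\<mu> i)) UNIV)" .
  qed
qed simp

text \<open>Both sides equal the sum \<open>L\<close> over all finite sets: grouping by cardinality
  gives the series, and exhausting by the power sets of initial segments gives the partial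
  products.\<close>

lemma tendsto_prod_one_plus_elementary_symmetric:
  fixes \<mu> :: "nat \<Rightarrow> complex"
  assumes "\<mu> abs_summable_on UNIV"
  shows "(\<lambda>N. \<Prod>i<N. 1 + \<mu> i) \<longlonglongrightarrow>
    (\<Sum>n. \<Sum>\<^sub>\<infinity>J\<in>{J. J \<subseteq> UNIV \<and> finite J \<and> card J = n}. \<Prod>i\<in>J. \<mu> i)"
proof -
  let ?p = "\<lambda>J. \<Prod>i\<in>J. \<mu> i"
  let ?C = "\<lambda>n. {J :: nat set. J \<subseteq> UNIV \<and> finite J \<and> card J = n}"
  define L where "L = infsum ?p {J. finite J}"
  have sum: "(?p has_sum L) {J. finite J}"
    unfolding L_def by (rule has_sum_infsum[OF abs_summable_summable[OF abs_summable_on_finite_subset_products[OF assms]]])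
  have bij: "bij_betw (\<lambda>J. (card J, J)) {J. finite J} (SIGMA n:UNIV. ?C n)"
    by (rule bij_betw_byWitness[where f' = snd]) auto
  have "((\<lambda>(n, J). ?p J) has_sum L) (SIGMA n:UNIV. ?C n)"
    by (rule has_sum_reindex_bij_betw[OF bij, THEN iffD1]) (use sum in \<open>simp only: prod.case\<close>)
  then have "((\<lambda>n. infsum ?p (?C n)) has_sum L) UNIV"
  proof (rule has_sum_Sigma')
    fix n
    have "?p summable_on ?C n"
      by (rule summable_on_subset_banach[OF has_sum_imp_summable[OF sum]]) auto
    then show "((\<lambda>J. case (n, J) of (n, J) \<Rightarrow> ?p J) has_sum infsum ?p (?C n)) (?C n)"
      by simp
  qed
  then have "(\<Sum>n. infsum ?p (?C n)) = L"
    by (rule has_sum_imp_sums[THEN sums_unique, symmetric])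
  moreover have "filterlim (\<lambda>N. Pow {..<N}) (finite_subsets_at_top {J :: nat set. finite J}) sequentially"
    unfolding filterlim_finite_subsets_at_top
  proof (intro allI impI)
    fix X :: "nat set set" assume X: "finite X \<and> X \<subseteq> {J. finite J}"
    then have "finite (\<Union>X)"
      by auto
    then obtain M where "\<Union>X \<subseteq> {..<M}"
      unfolding finite_nat_iff_bounded by (rule exE)
    have "J \<subseteq> {..<N}" if "N \<ge> M" "J \<in> X" for N J
    proof -
      have "J \<subseteq> \<Union>X"
        using that(2) by (rule Union_upper)
      also have "\<dots> \<subseteq> {..<M}"
        by fact
      also have "\<dots> \<subseteq> {..<N}"
        using that(1) by simp
      finally show ?thesis .
    qed
    then have "X \<subseteq> Pow {..<N}" if "N \<ge> M" for N
      using that by (simp add: subset_iff)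
    moreover have "Pow {..<N} \<subseteq> {J. finite J}" for N :: nat
      using finite_subset[OF _ finite_lessThan] by blast
    ultimately show "\<forall>\<^sub>F N in sequentially. finite (Pow {..<N}) \<and> X \<subseteq> Pow {..<N} \<and> Pow {..<N} \<subseteq> {J. finite J}"
      by (intro eventually_sequentiallyI[of M]) (simp only: finite_Pow_iff finite_lessThan simp_thms)
  qed
  then have "(\<lambda>N. sum ?p (Pow {..<N})) \<longlonglongrightarrow> L"
    using sum unfolding has_sum_def by (rule filterlim_compose[rotated])
  ultimately show ?thesis
    by (simp only: prod_one_plus_eq_sum_Pow[OF finite_lessThan])
qed

lemma prod_square_blocks:
  fixes h :: "nat \<Rightarrow> 'a::comm_monoid_mult"
  shows "(\<Prod>n<L\<^sup>2. h (floor_sqrt n)) = (\<Prod>l<L. h l ^ (2*l + 1))"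
proof (induction L)
  case (Suc L)
  have split: "(\<Prod>n<m+k. g n) = (\<Prod>n<m. g n) * (\<Prod>n<k. g (m + n))" for g :: "nat \<Rightarrow> 'a" and m k
    by (induction k) (simp_all add: mult.assoc)
  have "(Suc L)\<^sup>2 = L\<^sup>2 + (2*L + 1)"
    by (simp add: power2_eq_square)
  then have "(\<Prod>n<(Suc L)\<^sup>2. h (floor_sqrt n)) = (\<Prod>l<L. h l ^ (2*l + 1)) * (\<Prod>k<2*L + 1. h (floor_sqrt (L\<^sup>2 + k)))"
    by (simp only: split Suc)
  also have "(\<Prod>k<2*L + 1. h (floor_sqrt (L\<^sup>2 + k))) = (\<Prod>k<2*L + 1. h L)"
    by (intro prod.cong) (auto simp: floor_sqrt_square_add)
  finally show ?case
    by simp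
qed simp

text \<open>\<open>has_prod\<close> demands more than a limit of partial products: when a factor
  vanishes, the tail must still have a nonzero limit. Absolute convergence of the blocks supplies
  this, and \<open>lim\<close> then identifies the value.\<close>

lemma has_prod_power_blocks:
  fixes x :: "nat \<Rightarrow> complex"
  assumes x: "summable (\<lambda>l. real (2*l + 1) * norm (x l))"
    and lim: "(\<lambda>N. \<Prod>n<N. 1 + x (floor_sqrt n)) \<longlonglongrightarrow> P"
  shows "(\<lambda>l. (1 + x l) ^ (2*l + 1)) has_prod P"
proof (rule convergent_prod_tendsto_imp_has_prod)
  let ?y = "\<lambda>l. real (2*l + 1) * norm (x l)"
  have "abs_convergent_prod (\<lambda>l. (1 + x l) ^ (2*l + 1))"
    unfolding abs_convergent_prod_conv_summable
  proof (rule summable_comparison_test_ev)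
    have "?y \<longlonglongrightarrow> 0"
      using x by (rule summable_LIMSEQ_zero)
    then have "eventually (\<lambda>l. ?y l < 1) sequentially"
      by (rule order_tendstoD) simp
    then show "eventually (\<lambda>l. norm (norm ((1 + x l) ^ (2*l + 1) - 1)) \<le> 2 * ?y l) sequentially"
    proof eventually_elim
      case (elim l)
      have "norm ((1 + x l) ^ (2*l + 1) - 1) \<le> (1 + norm (x l)) ^ (2*l + 1) - 1"
        using norm_prod_minus1_le_prod_minus1[of "\<lambda>_. x l" "{..<2*l + 1}"] by simp
      also have "\<dots> \<le> exp (?y l) - 1"
        using prod_le_exp_sum[of "{..<2*l + 1}" "\<lambda>_. norm (x l)"] by simp
      also have "\<dots> \<le> ?y l + (?y l)\<^sup>2"
        using exp_bound[of "?y l"] elim by simp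
      also have "(?y l)\<^sup>2 \<le> ?y l"
        using elim by (simp only: power2_eq_square) (rule mult_left_le, auto)
      finally have "norm ((1 + x l) ^ (2*l + 1) - 1) \<le> 2 * ?y l"
        by linarith
      then show ?case
        by (simp only: real_norm_def abs_norm_cancel)
    qed
    show "summable (\<lambda>l. 2 * ?y l)"
      using x by (rule summable_mult)
  qed
  then show "convergent_prod (\<lambda>l. (1 + x l) ^ (2*l + 1))"
    by (rule abs_convergent_prod_imp_convergent_prod)
  \<comment> \<open>Partial products cut at a square consist of complete blocks.\<close>
  have "(\<lambda>L. \<Prod>n<L\<^sup>2. 1 + x (floor_sqrt n)) \<longlonglongrightarrow> P"
    using LIMSEQ_subseq_LIMSEQ[OF lim, of "\<lambda>L. L\<^sup>2"] by (simp add: strict_mono_def power_strict_mono o_def)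
  then have "(\<lambda>L. \<Prod>l<L. (1 + x l) ^ (2*l + 1)) \<longlonglongrightarrow> P"
    by (simp only: prod_square_blocks[where h = "\<lambda>l. 1 + x l"])
  then show "(\<lambda>n. \<Prod>l\<le>n. (1 + x l) ^ (2*l + 1)) \<longlonglongrightarrow> P"
    unfolding lessThan_Suc_atMost[symmetric] by (rule LIMSEQ_Suc)
qed

text \<open>For x \<le> 1 use that x is at most its power; for x > 1 bound the logarithm by a power
  of 1 + x \<le> 2x. The 2 in the constant covers the power of 2 that this produces.\<close>

lemma ln_one_plus_le_powr:
  fixes x \<delta> :: real
  assumes "x \<ge> 0" "0 < \<delta>" "\<delta> \<le> 1"
  shows "1 + x \<le> exp (2 / \<delta> * x powr \<delta>)"
proof (cases "x \<le> 1")
  case True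
  have "x \<le> x powr \<delta>"
    using powr_mono'[of \<delta> 1 x] assms True by simp
  also have "\<dots> \<le> 2 / \<delta> * x powr \<delta>"
    using assms by (intro mult_right_mono[of 1 "2 / \<delta>" "x powr \<delta>", unfolded mult_1_left]) (auto simp: field_simps)
  finally show ?thesis
    using exp_ge_add_one_self[of "2 / \<delta> * x powr \<delta>"] by linarith
next
  case False
  have "ln (1 + x) \<le> (1 + x) powr \<delta> / \<delta>"
    using assms by (intro ln_powr_bound) auto
  also have "(1 + x) powr \<delta> \<le> (2 * x) powr \<delta>"
    using False assms by (intro powr_mono2) auto
  also have "(2 * x) powr \<delta> = 2 powr \<delta> * x powr \<delta>"
    using assms by (simp add: powr_mult)
  also have "\<dots> \<le> 2 * x powr \<delta>"
    using powr_mono[of \<delta> 1 "2::real"] assms by (intro mult_right_mono) auto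
  finally have "ln (1 + x) \<le> 2 / \<delta> * x powr \<delta>"
    using assms by (simp add: divide_right_mono)
  then have "exp (ln (1 + x)) \<le> exp (2 / \<delta> * x powr \<delta>)"
    by (simp only: exp_le_cancel_iff)
  then show ?thesis
    using assms by simp
qed

section \<open>The eigenvalues: summability, product, growth and zeros of the determinant\<close>

context
  fixes \<tau> :: real
  assumes \<tau>: "\<tau> > 0"
begin

text \<open>Block \<open>l\<close> contributes at most 2(l+1) q^l, with q < 1 the
  \<open>\<delta>\<close>-th power of 1/4, which is a differentiated geometric series. Arbitrarily
  small \<open>\<delta>\<close> is what yields order zero.\<close>

lemma summable_on_s_coef_powr:
  assumes \<delta>: "\<delta> > 0"
  shows "(\<lambda>n. s_coef (floor_sqrt n) \<tau> powr \<delta>) summable_on UNIV"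
proof (rule summable_on_square_blocks)
  define q where "q = (1 / 4 :: real) powr \<delta>"
  have q: "0 < q" "q < 1"
    using \<delta> powr_less_mono2[of \<delta> "1/4" 1] by (auto simp: q_def)
  have eq: "(\<Sum>k\<le>2*l. s_coef (floor_sqrt (l\<^sup>2 + k)) \<tau> powr \<delta>) = real (2*l + 1) * s_coef l \<tau> powr \<delta>" for l
  proof -
    have "(\<Sum>k\<le>2*l. s_coef (floor_sqrt (l\<^sup>2 + k)) \<tau> powr \<delta>) = (\<Sum>k\<le>2*l. s_coef l \<tau> powr \<delta>)"
      by (intro sum.cong) (auto simp: floor_sqrt_square_add)
    then show ?thesis
      by simp
  qed
  have "summable (\<lambda>l. real (2*l + 1) * s_coef l \<tau> powr \<delta>)"
  proof (rule summable_comparison_test')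
    show "summable (\<lambda>l. 2 * (of_nat (Suc l) * q ^ l))"
      using geometric_deriv_sums[of q] q by (intro summable_mult) (auto simp: sums_iff)
    fix l :: nat
    have "s_coef l \<tau> powr \<delta> \<le> ((1 / 4) ^ l) powr \<delta>"
      using s_coef_le[OF \<tau>, of l] s_coef_pos[OF \<tau>, of l] \<delta> by (intro powr_mono2) auto
    also have "\<dots> = q ^ l"
      by (simp add: q_def powr_realpow[symmetric] powr_powr mult.commute)
    finally have "real (2*l + 1) * s_coef l \<tau> powr \<delta> \<le> real (2 * Suc l) * q ^ l"
      by (intro mult_mono) auto
    also have "\<dots> = 2 * (of_nat (Suc l) * q ^ l)"
      by (simp only: of_nat_mult of_nat_numeral mult.assoc)
    finally show "norm (real (2*l + 1) * s_coef l \<tau> powr \<delta>) \<le> 2 * (of_nat (Suc l) * q ^ l)"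
      by (simp only: real_norm_def) simp
  qed
  then show "(\<lambda>l. \<Sum>k\<le>2*l. s_coef (floor_sqrt (l\<^sup>2 + k)) \<tau> powr \<delta>) summable_on UNIV"
    unfolding eq by (subst summable_on_UNIV_nonneg_real_iff) auto
qed simp

lemma summable_on_s_coef: "(\<lambda>n. s_coef (floor_sqrt n) \<tau>) summable_on UNIV"
  using summable_on_s_coef_powr[of 1] s_coef_pos[OF \<tau>] by (simp add: less_imp_le)

lemma summable_s_coef: "summable (\<lambda>n. s_coef (floor_sqrt n) \<tau>)"
  using summable_on_s_coef s_coef_pos[OF \<tau>] by (subst summable_on_UNIV_nonneg_real_iff[symmetric]) (auto intro: less_imp_le)

lemma summable_s_coef_blocks: "summable (\<lambda>l. real (2*l + 1) * s_coef l \<tau>)"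
proof -
  have "(\<Sum>k\<le>2*l. s_coef (floor_sqrt (l\<^sup>2 + k)) \<tau>) = (\<Sum>k\<le>2*l. s_coef l \<tau>)" for l
    by (intro sum.cong) (auto simp: floor_sqrt_square_add)
  then have "((\<lambda>l. real (2*l + 1) * s_coef l \<tau>) has_sum infsum (\<lambda>n. s_coef (floor_sqrt n) \<tau>) UNIV) UNIV"
    using has_sum_square_blocks[OF has_sum_infsum[OF summable_on_s_coef]] by simp
  then show ?thesis
    using has_sum_imp_sums sums_summable by blast
qed

lemma D_T_tendsto: "(\<lambda>N. \<Prod>n<N. 1 + - z * of_real (s_coef (floor_sqrt n) \<tau>)) \<longlonglongrightarrow> D_T \<tau> z"
proof -
  have "(\<lambda>n. - z * of_real (s_coef (floor_sqrt n) \<tau>)) abs_summable_on UNIV"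
    unfolding norm_mult norm_of_real
    using summable_on_s_coef s_coef_pos[OF \<tau>] by (intro summable_on_cmult_right) (simp add: abs_of_pos)
  from tendsto_prod_one_plus_elementary_symmetric[OF this] show ?thesis
    unfolding D_T_def det_id_plus_def trace_ext_power_eq[OF \<tau> summable_on_s_coef] .
qed

text \<open>The zeros are listed with repetition, each 1/s_l occurring 2l+1 times for its block.
  Genus 0 suffices, as the convergence condition at radius \<open>r\<close> is the summability of
  \<open>r\<close> times the eigenvalues.\<close>

lemma weierstrass_product_s_coef:
  "weierstrass_product (\<lambda>n. 1 / of_real (s_coef (floor_sqrt n) \<tau>)) (\<lambda>_. 0)"
proof
  show "1 / complex_of_real (s_coef (floor_sqrt n) \<tau>) \<noteq> 0" for n
    using s_coef_pos[OF \<tau>, of "floor_sqrt n"] by simp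
  have "filterlim (\<lambda>n. inverse (s_coef (floor_sqrt n) \<tau>)) at_top sequentially"
    using summable_LIMSEQ_zero[OF summable_s_coef] s_coef_pos[OF \<tau>]
    by (intro filterlim_inverse_at_top) auto
  then show "filterlim (\<lambda>n. 1 / complex_of_real (s_coef (floor_sqrt n) \<tau>)) at_infinity sequentially"
    using s_coef_pos[OF \<tau>]
    by (intro filterlim_norm_at_top_imp_at_infinity) (simp add: norm_divide inverse_eq_divide abs_of_pos)
  show "summable (\<lambda>n. (r / norm (1 / complex_of_real (s_coef (floor_sqrt n) \<tau>))) ^ Suc 0)" if "r > 0" for r
    using summable_mult[OF summable_s_coef, of r] s_coef_pos[OF \<tau>] by (simp add: norm_divide abs_of_pos)
qed

lemma weierstrass_factor_0_left: "weierstrass_factor 0 z = 1 - z"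
  by (simp add: weierstrass_factor_def)

lemma D_T_eq_weierstrass_product:
  "D_T \<tau> = weierstrass_product.f (\<lambda>n. 1 / of_real (s_coef (floor_sqrt n) \<tau>)) (\<lambda>_. 0)"
proof
  fix z
  interpret W: weierstrass_product "\<lambda>n. 1 / of_real (s_coef (floor_sqrt n) \<tau>)" "\<lambda>_. 0"
    by (rule weierstrass_product_s_coef)
  have "(\<lambda>N. \<Prod>n\<le>N. 1 + - z * of_real (s_coef (floor_sqrt n) \<tau>)) \<longlonglongrightarrow> W.f z"
    using has_prod_imp_tendsto[OF W.has_prod[of z]] by (simp add: weierstrass_factor_0_left)
  moreover have "(\<lambda>N. \<Prod>n\<le>N. 1 + - z * of_real (s_coef (floor_sqrt n) \<tau>)) \<longlonglongrightarrow> D_T \<tau> z"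
    using LIMSEQ_Suc[OF D_T_tendsto[of z]] by (simp only: lessThan_Suc_atMost)
  ultimately show "D_T \<tau> z = W.f z"
    using LIMSEQ_unique by blast
qed

lemma D_T_has_prod: "(\<lambda>l. (1 - z * of_real (s_coef l \<tau>)) ^ (2*l + 1)) has_prod D_T \<tau> z"
proof -
  have "summable (\<lambda>l. real (2*l + 1) * norm (- z * of_real (s_coef l \<tau>)))"
    using summable_mult[OF summable_s_coef_blocks, of "norm z"] s_coef_pos[OF \<tau>]
    by (simp add: norm_mult abs_of_pos mult_ac)
  from has_prod_power_blocks[OF this D_T_tendsto] show ?thesis
    by simp
qed

text \<open>The estimate is made factor by factor on partial products with an exponent independent
  of \<open>N\<close>, and then passes to the limit.\<close>

lemma D_T_growth:
  assumes "0 < \<delta>" "\<delta> \<le> 1"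
  shows "\<exists>K\<ge>0. \<forall>z. cmod (D_T \<tau> z) \<le> exp (K * cmod z powr \<delta>)"
proof (intro exI conjI allI)
  let ?S = "infsum (\<lambda>n. s_coef (floor_sqrt n) \<tau> powr \<delta>) UNIV"
  show "0 \<le> 2 / \<delta> * ?S"
    using assms by (intro mult_nonneg_nonneg infsum_nonneg) auto
  fix z
  have "cmod (\<Prod>n<N. 1 + - z * of_real (s_coef (floor_sqrt n) \<tau>)) \<le> exp (2 / \<delta> * ?S * cmod z powr \<delta>)" for N
  proof -
    have "cmod (\<Prod>n<N. 1 + - z * of_real (s_coef (floor_sqrt n) \<tau>)) \<le>
        (\<Prod>n<N. exp (2 / \<delta> * (cmod z * s_coef (floor_sqrt n) \<tau>) powr \<delta>))"
      unfolding prod_norm[symmetric]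
    proof (intro prod_mono conjI)
      fix n
      have "cmod (1 + - z * of_real (s_coef (floor_sqrt n) \<tau>)) \<le> 1 + cmod z * s_coef (floor_sqrt n) \<tau>"
        using norm_triangle_ineq[of 1 "- z * of_real (s_coef (floor_sqrt n) \<tau>)"] s_coef_pos[OF \<tau>]
        by (simp add: norm_mult abs_of_pos)
      also have "\<dots> \<le> exp (2 / \<delta> * (cmod z * s_coef (floor_sqrt n) \<tau>) powr \<delta>)"
        using assms s_coef_pos[OF \<tau>] by (intro ln_one_plus_le_powr mult_nonneg_nonneg) (auto intro: less_imp_le)
      finally show "cmod (1 + - z * of_real (s_coef (floor_sqrt n) \<tau>)) \<le>
          exp (2 / \<delta> * (cmod z * s_coef (floor_sqrt n) \<tau>) powr \<delta>)" .
    qed simp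
    also have "\<dots> = exp (2 / \<delta> * (\<Sum>n<N. s_coef (floor_sqrt n) \<tau> powr \<delta>) * cmod z powr \<delta>)"
      using s_coef_pos[OF \<tau>]
      by (simp add: exp_sum[symmetric] powr_mult less_imp_le sum_distrib_left sum_distrib_right mult_ac)
    also have "\<dots> \<le> exp (2 / \<delta> * ?S * cmod z powr \<delta>)"
      using assms finite_sum_le_infsum[OF summable_on_s_coef_powr[OF assms(1)], of "{..<N}"]
      by (simp add: mult_right_mono mult_left_mono divide_right_mono)
    finally show ?thesis .
  qed
  then show "cmod (D_T \<tau> z) \<le> exp (2 / \<delta> * ?S * cmod z powr \<delta>)"
    using LIMSEQ_le_const2[OF tendsto_norm[OF D_T_tendsto[of z]]] by blast
qed

lemma ln_D_T_le:
  assumes "\<epsilon> > 0"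
  shows "\<exists>C. \<forall>z. ln (cmod (D_T \<tau> z)) \<le> C * (1 + cmod z) powr \<epsilon>"
proof -
  \<comment> \<open>The growth bound needs an exponent at most 1; a larger \<open>\<epsilon>\<close>
    follows because the base 1 + |z| is at least 1.\<close>
  obtain K where K: "K \<ge> 0" "\<And>z. cmod (D_T \<tau> z) \<le> exp (K * cmod z powr (min \<epsilon> 1))"
    using D_T_growth[of "min \<epsilon> 1"] assms by auto
  have "ln (cmod (D_T \<tau> z)) \<le> K * (1 + cmod z) powr \<epsilon>" for z
  proof (cases "D_T \<tau> z = 0")
    case False
    have "ln (cmod (D_T \<tau> z)) \<le> ln (exp (K * cmod z powr (min \<epsilon> 1)))"
      using K(2)[of z] False by (subst ln_le_cancel_iff) auto
    also have "\<dots> \<le> K * (1 + cmod z) powr (min \<epsilon> 1)"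
      using K(1) assms by (auto intro!: mult_left_mono powr_mono2)
    also have "\<dots> \<le> K * (1 + cmod z) powr \<epsilon>"
      using K(1) by (intro mult_left_mono powr_mono) auto
    finally show ?thesis .
  \<comment> \<open>At a zero of the determinant \<open>ln 0 = 0\<close> by convention, and the
    right-hand side is nonnegative.\<close>
  qed (use K(1) in simp)
  then show ?thesis
    by blast
qed

text \<open>The lower bound comes from the point -r, where every factor is real and at least 1, so
  the factor of l = 0 alone can be kept.\<close>

lemma max_modulus_D_T_bounds:
  assumes K: "\<And>z. cmod (D_T \<tau> z) \<le> exp (K * cmod z powr \<delta>)" and r: "r \<ge> 0"
  shows "max_modulus (D_T \<tau>) r \<le> exp (K * r powr \<delta>)" and "1 + r * s_coef 0 \<tau> \<le> max_modulus (D_T \<tau>) r"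
proof -
  have r_in: "- of_real r \<in> sphere (0::complex) r"
    using r by simp
  show "max_modulus (D_T \<tau>) r \<le> exp (K * r powr \<delta>)"
    unfolding max_modulus_def using K r_in by (intro cSUP_least) fastforce+
  have "1 + r * s_coef 0 \<tau> \<le> cmod (D_T \<tau> (- of_real r))"
  proof (rule LIMSEQ_le_const[OF tendsto_norm[OF D_T_tendsto]], intro exI allI impI)
    fix N :: nat assume "1 \<le> N"
    have s: "1 \<le> 1 + r * s_coef l \<tau>" for l
      using r s_coef_pos[OF \<tau>, of l] by simp
    have eq: "1 + - (- of_real r) * complex_of_real (s_coef l \<tau>) = of_real (1 + r * s_coef l \<tau>)" for l
      by simp
    have "1 + r * s_coef 0 \<tau> = (\<Prod>n\<in>{0}. 1 + r * s_coef (floor_sqrt n) \<tau>)"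
      by simp
    also have "\<dots> \<le> (\<Prod>n<N. 1 + r * s_coef (floor_sqrt n) \<tau>)"
      using \<open>1 \<le> N\<close> s by (intro prod_mono2) (auto intro: order_trans[OF zero_le_one])
    also have "\<dots> = cmod (\<Prod>n<N. 1 + - (- of_real r) * of_real (s_coef (floor_sqrt n) \<tau>))"
      unfolding eq prod_norm[symmetric] norm_of_real
      by (intro prod.cong refl abs_of_nonneg[symmetric] order_trans[OF zero_le_one s])
    finally show "1 + r * s_coef 0 \<tau> \<le> cmod (\<Prod>n<N. 1 + - (- of_real r) * of_real (s_coef (floor_sqrt n) \<tau>))" .
  qed
  also have "\<dots> \<le> max_modulus (D_T \<tau>) r"
    unfolding max_modulus_def using K
    by (intro cSUP_upper[OF r_in] bdd_aboveI2[where M = "exp (K * r powr \<delta>)"]) fastforce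
  finally show "1 + r * s_coef 0 \<tau> \<le> max_modulus (D_T \<tau>) r" .
qed

lemma entire_order_D_T: "entire_order (D_T \<tau>) = 0"
proof (rule antisym)
  let ?M = "max_modulus (D_T \<tau>)"
  \<comment> \<open>Maximum modulus at least e keeps the iterated logarithm nonnegative, which gives
    the lower bound on the order.\<close>
  have M_ge: "eventually (\<lambda>r. r > 1 \<and> exp 1 \<le> ?M r) at_top"
  proof -
    obtain K where K: "\<And>z. cmod (D_T \<tau> z) \<le> exp (K * cmod z powr 1)"
      using D_T_growth[of 1] by auto
    show ?thesis
      using eventually_gt_at_top[of 1] eventually_ge_at_top[of "exp 1 / s_coef 0 \<tau>"]
    proof eventually_elim
      case (elim r)
      then have "exp 1 \<le> 1 + r * s_coef 0 \<tau>"
        using s_coef_pos[OF \<tau>, of 0] by (simp add: divide_le_eq)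
      then show ?case
        using elim max_modulus_D_T_bounds(2)[OF K, of r] by simp
    qed
  qed
  show "0 \<le> entire_order (D_T \<tau>)"
    unfolding entire_order_def
  proof (rule le_Limsup)
    show "eventually (\<lambda>r. 0 \<le> ereal (ln (ln (?M r)) / ln r)) at_top"
      using M_ge
    proof eventually_elim
      case (elim r)
      then have "1 \<le> ln (?M r)"
        by (subst ln_ge_iff) (auto intro: less_le_trans[OF exp_gt_zero])
      then show ?case
        using elim by simp
    qed
  qed simp
  show "entire_order (D_T \<tau>) \<le> 0"
  proof (rule ereal_le_epsilon2)
    fix e :: real assume "e > 0"
    \<comment> \<open>Half of \<open>e\<close> pays for the exponent of \<open>r\<close>, the other
      half absorbs \<open>ln (K + 1)\<close> once \<open>r\<close> is large.\<close>
    define \<delta> where "\<delta> = min (e / 2) 1"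
    have \<delta>: "0 < \<delta>" "\<delta> \<le> 1" "\<delta> \<le> e / 2"
      using \<open>e > 0\<close> by (auto simp: \<delta>_def)
    obtain K where K: "K \<ge> 0" "\<And>z. cmod (D_T \<tau> z) \<le> exp (K * cmod z powr \<delta>)"
      using D_T_growth[OF \<delta>(1,2)] by auto
    have "eventually (\<lambda>r. ln (K + 1) / (e / 2) \<le> ln r) at_top"
      using ln_at_top by (simp add: filterlim_at_top)
    then have "eventually (\<lambda>r. ereal (ln (ln (?M r)) / ln r) \<le> ereal e) at_top"
      using M_ge
    proof eventually_elim
      case (elim r)
      have M_pos: "0 < ?M r"
        using elim less_le_trans[OF exp_gt_zero] by blast
      have one: "1 \<le> ln (?M r)"
        using elim M_pos by (simp add: ln_ge_iff)
      have "ln (?M r) \<le> ln (exp (K * r powr \<delta>))"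
        using max_modulus_D_T_bounds(1)[OF K(2), of r] elim M_pos by (subst ln_le_cancel_iff) auto
      also have "\<dots> = K * r powr \<delta>"
        by simp
      \<comment> \<open>\<open>K\<close> may be 0; with \<open>K + 1\<close> the next logarithm has
        a positive argument.\<close>
      also have "\<dots> \<le> (K + 1) * r powr \<delta>"
        by (intro mult_right_mono) auto
      finally have "ln (ln (?M r)) \<le> ln ((K + 1) * r powr \<delta>)"
        using one K(1) elim by (subst ln_le_cancel_iff) auto
      also have "\<dots> = ln (K + 1) + \<delta> * ln r"
        using K(1) elim by (simp add: ln_mult ln_powr)
      also have "\<dots> \<le> (e / 2) * ln r + (e / 2) * ln r"
        using elim \<delta> \<open>e > 0\<close> by (intro add_mono mult_right_mono) (auto simp: field_simps)
      finally show ?case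
        using elim by (simp add: divide_le_eq)
    qed
    then have "entire_order (D_T \<tau>) \<le> ereal e"
      unfolding entire_order_def by (rule Limsup_bounded)
    then show "entire_order (D_T \<tau>) \<le> 0 + ereal e"
      by simp
  qed
qed

text \<open>The order at \<open>c\<close> is the number of indices \<open>n\<close> whose listed
  zero is \<open>c\<close>. These form whole blocks of length 2l+1, summed over all \<open>l\<close>
  with that zero, so coinciding zeros of different blocks are accounted for.\<close>

lemma canonical_product_D_T:
  "canonical_product 0 (\<lambda>l. 1 / of_real (s_coef l \<tau>)) (\<lambda>l. 2 * l + 1) (D_T \<tau>)"
proof -
  let ?a = "\<lambda>l. 1 / complex_of_real (s_coef l \<tau>)"
  interpret W: weierstrass_product "\<lambda>n. ?a (floor_sqrt n)" "\<lambda>_. 0"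
    by (rule weierstrass_product_s_coef)
  have fin: "finite {l. ?a l = c}" for c
  proof (rule finite_subset)
    show "{l. ?a l = c} \<subseteq> floor_sqrt ` ((\<lambda>n. ?a (floor_sqrt n)) -` {c})"
    proof
      fix l assume "l \<in> {l. ?a l = c}"
      then show "l \<in> floor_sqrt ` ((\<lambda>n. ?a (floor_sqrt n)) -` {c})"
        \<comment> \<open>The first index of block \<open>l\<close> serves as preimage.\<close>
        by (intro image_eqI[of _ _ "l\<^sup>2"]) auto
    qed
  qed (rule finite_imageI[OF W.finite_occs_a])
  have zorder: "zorder (D_T \<tau>) c = int (\<Sum>l | ?a l = c. 2 * l + 1)" for c
  proof -
    have "bij_betw (\<lambda>(l, k). l\<^sup>2 + k) (SIGMA l:{l. ?a l = c}. {..2*l})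
        ((\<lambda>(l, k). l\<^sup>2 + k) ` (SIGMA l:{l. ?a l = c}. {..2*l}))"
      by (rule bij_betw_subset[OF bij_betw_square_add]) auto
    moreover have "(\<lambda>(l, k). l\<^sup>2 + k) ` (SIGMA l:{l. ?a l = c}. {..2*l}) = (\<lambda>n. ?a (floor_sqrt n)) -` {c}"
    proof safe
      fix n assume n: "c = ?a (floor_sqrt n)"
      obtain l k :: nat where lk: "k \<le> 2*l" "n = l\<^sup>2 + k"
        by (rule square_add_cases)
      then show "n \<in> (\<lambda>(l, k). l\<^sup>2 + k) ` (SIGMA l:{l. ?a l = ?a (floor_sqrt n)}. {..2*l})"
        by (intro image_eqI[of _ _ "(l, k)"]) (auto simp: floor_sqrt_square_add)
    qed (auto simp: floor_sqrt_square_add)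
    ultimately have "card ((\<lambda>n. ?a (floor_sqrt n)) -` {c}) = card (SIGMA l:{l. ?a l = c}. {..2*l})"
      using bij_betw_same_card by metis
    then show ?thesis
      using W.zorder[of c] fin[of c] by (simp add: D_T_eq_weierstrass_product)
  qed
  show ?thesis
    unfolding canonical_product_def
  proof (intro conjI allI impI)
    show "?a l \<noteq> 0" for l
      using s_coef_pos[OF \<tau>, of l] by simp
    show "summable (\<lambda>l. real (2*l + 1) / cmod (?a l) ^ (0 + 1))"
      using summable_s_coef_blocks s_coef_pos[OF \<tau>] by (simp add: norm_divide abs_of_pos)
    show "(\<lambda>l. weierstrass_factor 0 (z / ?a l) ^ (2*l + 1)) has_prod D_T \<tau> z" for z
      using D_T_has_prod[of z] by (simp add: weierstrass_factor_0_left)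
  qed (use fin zorder in auto)
qed

end

theorem theorem10p1:
  fixes \<tau> :: real
  assumes "\<tau> > 0"
  shows "D_T \<tau> holomorphic_on UNIV \<and>
    (\<forall>z::complex. (\<lambda>l. (1 - z * of_real (s_coef l \<tau>)) ^ (2 * l + 1)) has_prod D_T \<tau> z) \<and>
    entire_order (D_T \<tau>) = 0 \<and>
    (\<forall>\<epsilon>::real. \<epsilon> > 0 \<longrightarrow>
      (\<exists>C::real. \<forall>z::complex. ln (cmod (D_T \<tau> z)) \<le> C * (1 + cmod z) powr \<epsilon>)) \<and>
    canonical_product 0 (\<lambda>l. 1 / of_real (s_coef l \<tau>)) (\<lambda>l. 2 * l + 1) (D_T \<tau>)"
proof (intro conjI allI impI)
  show "D_T \<tau> holomorphic_on UNIV"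
    unfolding D_T_eq_weierstrass_product[OF assms]
    by (rule weierstrass_product.holomorphic[OF weierstrass_product_s_coef[OF assms]])
qed (use D_T_has_prod[OF assms] entire_order_D_T[OF assms] ln_D_T_le[OF assms]
  canonical_product_D_T[OF assms] in auto)

end
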